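(* Let $(P_t)_{t\ge 0}$ be a Markov semigroup on $\mathcal M_b(\mathbb R^d)$, let $(\overline P_\gamma)_{\gamma>0}$ be one-step approximation operators, and let $(\gamma_n)_{n\ge1}$ be a sequence of time steps, all as in the context. Fix $\beta>0$ and $p\ge 1$. Suppose: (1) there are $\alpha>0$, $k_0\in\mathbb N$ and a constant $C$ such that $\|(P_\gamma-\overline P_\gamma)\varphi\|_\infty\le C\|\nabla\varphi\|_{k_0,\infty}\,\gamma^{1+\alpha}$ for every $\gamma>0$ and every $\varphi\in C_b^{k_0+1}(\mathbb R^d)$; (2) for every $k$ there is a constant $C_k$ such that $\sup_{1\le t\le 2}\|\nabla P_t\varphi\|_{k-1,\infty}\le C_k\|\varphi\|_\infty$ for every $\varphi\in\mathcal M_b(\mathbb R^d)$; (3) for every $k$ there is a constant $C_k'$ such that $\sup_{1\le t\le 2}\|\nabla P_t\varphi\|_{k-1,\infty}\le C'_k\|\nabla\varphi\|_\infty$ for every $\varphi\in C_b^1(\mathbb R^d)$; (4) there is $\rho>0$ with $\rho>\alpha\overline\omega$ such that for every $k$ there is a constant $C_k$ with: $\|\nabla P_t\varphi\|_\infty\le C_k\|\nabla\varphi\|_{k,\infty}e^{-\rho t}$ for $t\ge 1$, and $\|\nabla P_t\varphi\|_{k,\infty}\le C_k\|\nabla\varphi\|_{k,\infty}$ for $0<t\le 1$, for every $\varphi\in C_b^{k+1}(\mathbb R^d)$; (5) for every $q,\kappa\in\mathbb N$ there is a constant $C_{q,\kappa,p}$ such that for every $\delta>0$, $\eta>0$, every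 $t,r\in\{\Gamma\}$ with $1<t<r<t+2$ and every bounded measurable $\varphi$, $$\|\overline P_{t-1,t}P_{t,r}\varphi-\overline P_{t-1,t}P_{t,r}\varphi_\delta\|_\infty+\|\overline P_{t-1,t}\overline P_{t,r}\varphi-\overline P_{t-1,t}\overline P_{t,r}\varphi_\delta\|_\infty\le C_{q,\kappa,p}\Big(\frac{\delta^q}{\eta^{2q}}+\eta^{-p}\gamma_{N(t-1)}^{\beta p}+\eta^\kappa\Big)\|\varphi\|_\infty .$$ Then for every $\varepsilon>0$ there is a constant $C_\varepsilon$ such that for every bounded measurable $\varphi$ and every $n$ large enough that $N(\Gamma_n-3)>n_\ast$ and $N(\Gamma_n-2)>n_\rho+1$, $$\|(\overline P_{0,\Gamma_n}-P_{0,\Gamma_n})\varphi\|_\infty\le C_\varepsilon\|\varphi\|_\infty\,\gamma_n^{((p\beta)\wedge\alpha)-\varepsilon}.$$ Moreover, if an invariant probability measure $\nu$ of $(P_t)_{t\ge0}$ exists, then it is unique, and for every $\varepsilon>0$ there is $C_\varepsilon$ such that for every $x\in\mathbb R^d$ and all such $n$, $$d_{TV}(\overline P_{0,\Gamma_n}(x,\cdot),\nu)\le C_\varepsilon\Big(\gamma_n^{((p\beta)\wedge\alpha)-\varepsilon}+\int_{\mathbb R^d}|x-y|\,d\nu(y)\,e^{-\rho\Gamma_n}\Big).$$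
   Context: $\mathcal M_b(\mathbb R^d)$ is the space of bounded measurable functions on $\mathbb R^d$; $C_b^l(\mathbb R^d)$ is the space of $l$-times differentiable bounded functions with bounded derivatives up to order $l$. $\|\psi\|_{k,\infty}=\sum_{|a|\le k}\|\partial^a\psi\|_\infty$. An estimate on $\|\nabla P_t\varphi\|_{k,\infty}$ includes the assertion that the derivatives involved exist. $(P_t)_{t\ge0}$ is a semigroup on $\mathcal M_b(\mathbb R^d)$ given by probability kernels $P_t(x,dy)$, and $P_{s,t}:=P_{t-s}$. A probability $\nu$ is invariant if $\int P_t\varphi\,d\nu=\int\varphi\,d\nu$ for all $t\geq 0$ and all $\varphi\in\mathcal M_b(\mathbb R^d)$. $d_{TV}(\mu,\nu)=\sup_{\|f\|_\infty\le1}|\int f\,d\mu-\int f\,d\nu|$. One-step operators: for each $\gamma>0$, $\overline P_\gamma$ is given by a probability kernel (so $\|\overline P_\gamma\varphi\|_\infty\le\|\varphi\|_\infty$) and maps $C_b^\infty(\mathbb R^d)$ into itself. Time grid: $(\gamma_n)_{n\ge1}$ is a decreasing sequence of positive numbers, $\gamma_n\downarrow0$, $\Gamma_0=0$, $\Gamma_n=\sum_{i=1}^n\gamma_i\to\infty$, $\{\Gamma\}=\{\Gamma_n:n\in\mathbb N\}$, and $\overline\omega:=\limsup_{n\to\infty}\frac{\gamma_n-\gamma_{n+1}}{\gamma_{n+1}^2}<\infty$. For $\Gamma_i\le t<\Gamma_{i+1}$ set $N(t)=i$ and $\tau(t)=\Gamma_i$. Euler scheme with decreasing steps: for $s<t$,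 $\overline P_{s,t}=\overline P_{\gamma_{N(s)+1}}\circ\overline P_{\gamma_{N(s)+2}}\circ\cdots\circ\overline P_{\gamma_{N(t)}}$ (the scheme goes from $\tau(s)$ to $\tau(t)$); $\overline P_{s,t}(x,\cdot)$ is its kernel. Super kernel: a fixed function $\phi$ in the Schwartz space on $\mathbb R^d$ with $\int\phi=1$, $\int y^{a}\phi(y)dy=0$ for every multi-index $|a|\ge1$, and $\int|y|^m|\partial^{b}\phi(y)|dy<\infty$ for all $m\in\mathbb N$ and all multi-indices $b$. $\phi_\delta(y)=\delta^{-d}\phi(y/\delta)$ and $\varphi_\delta=\varphi*\phi_\delta$. The integers $n_\rho$ and $n_\ast$: $n_\rho$ is an integer for which there is a constant $C_\rho$ with $\sum_{i=1}^n\gamma_i^{1+\alpha}e^{-\rho(\Gamma_n-\Gamma_i)}\le C_\rho\gamma_n^\alpha$ for all $n\ge n_\rho$; $n_\ast$ is an integer such that $\gamma_i\le e^{2\overline\omega(\Gamma_n-\Gamma_i)}\gamma_n$ for all $n_\ast\le i\le n$. *)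

theory Defs
  imports "HOL-Probability.Probability"
begin

section \<open>Derivatives and norms\<close>

definition partial :: "'d \<Rightarrow> (real ^ 'd::finite \<Rightarrow> 'b::real_normed_vector) \<Rightarrow> real ^ 'd \<Rightarrow> 'b" where
  "partial i f x = frechet_derivative f (at x) (axis i 1)"

text \<open>A multi-index is a function \<open>a :: 'd \<Rightarrow> nat\<close>. The type \<open>'d\<close> carries no order, so an
  arbitrary numbering of the coordinates is fixed; for functions that are \<open>|a|\<close> times
  differentiable the iterated partial derivative does not depend on it.\<close>

definition coords :: "'d::finite list" where
  "coords = (SOME is. distinct is \<and> set is = UNIV)"

definition mdeg :: "('d::finite \<Rightarrow> nat) \<Rightarrow> nat" where
  "mdeg a = (\<Sum>i\<in>UNIV. a i)"

definition mpartial ::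
  "('d \<Rightarrow> nat) \<Rightarrow> (real ^ 'd::finite \<Rightarrow> 'b::real_normed_vector) \<Rightarrow> real ^ 'd \<Rightarrow> 'b" where
  "mpartial a f = foldr (\<lambda>i. partial i ^^ a i) coords f"

definition mpower :: "real ^ 'd::finite \<Rightarrow> ('d \<Rightarrow> nat) \<Rightarrow> real" where
  "mpower y a = (\<Prod>i\<in>UNIV. (y $ i) ^ a i)"

definition grad :: "(real ^ 'd::finite \<Rightarrow> real) \<Rightarrow> real ^ 'd \<Rightarrow> real ^ 'd" where
  "grad f x = (\<chi> i. partial i f x)"

primrec times_differentiable ::
  "nat \<Rightarrow> (real ^ 'd::finite \<Rightarrow> 'b::real_normed_vector) \<Rightarrow> bool" where
  "times_differentiable 0 f \<longleftrightarrow> True"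
| "times_differentiable (Suc l) f \<longleftrightarrow>
     (\<forall>x. f differentiable (at x)) \<and> (\<forall>i. times_differentiable l (partial i f))"

text \<open>Norms take values in \<open>ennreal\<close>, so that an upper bound by a finite quantity
  entails boundedness.\<close>

definition sup_norm :: "(real ^ 'd::finite \<Rightarrow> 'b::real_normed_vector) \<Rightarrow> ennreal" where
  "sup_norm f = (SUP x. ennreal (norm (f x)))"

definition Ck_norm :: "nat \<Rightarrow> (real ^ 'd::finite \<Rightarrow> 'b::real_normed_vector) \<Rightarrow> ennreal" where
  "Ck_norm k f = (\<Sum>a | mdeg a \<le> k. sup_norm (mpartial a f))"

definition Mb :: "(real ^ 'd::finite \<Rightarrow> real) set" where
  "Mb = {f. f \<in> borel_measurable borel \<and> bounded (range f)}"

definition Cb :: "nat \<Rightarrow> (real ^ 'd::finite \<Rightarrow> real) set" where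
  "Cb l = {f. times_differentiable l f \<and> Ck_norm l f < \<infinity>}"

definition Cb_inf :: "(real ^ 'd::finite \<Rightarrow> real) set" where
  "Cb_inf = (\<Inter>l. Cb l)"

text \<open>The estimate \<open>\<parallel>\<nabla>\<psi>\<parallel>\<^bsub>k,\<infinity>\<^esub> \<le> B\<close>, including the existence of the derivatives of \<open>\<psi>\<close>
  up to order \<open>k + 1\<close>.\<close>

definition grad_estimate :: "nat \<Rightarrow> (real ^ 'd::finite \<Rightarrow> real) \<Rightarrow> ennreal \<Rightarrow> bool" where
  "grad_estimate k \<psi> B \<longleftrightarrow> times_differentiable (Suc k) \<psi> \<and> Ck_norm k (grad \<psi>) \<le> B"

section \<open>Kernels and semigroups\<close>

definition prob_kernel :: "(real ^ 'd::finite \<Rightarrow> (real ^ 'd) measure) \<Rightarrow> bool" where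
  "prob_kernel K \<longleftrightarrow> K \<in> borel \<rightarrow>\<^sub>M prob_algebra borel"

definition kernel_op ::
  "(real ^ 'd::finite \<Rightarrow> (real ^ 'd) measure) \<Rightarrow> (real ^ 'd \<Rightarrow> real) \<Rightarrow> real ^ 'd \<Rightarrow> real" where
  "kernel_op K f x = (\<integral>y. f y \<partial>K x)"

definition markov_semigroup :: "(real \<Rightarrow> real ^ 'd::finite \<Rightarrow> (real ^ 'd) measure) \<Rightarrow> bool" where
  "markov_semigroup P \<longleftrightarrow>
     (\<forall>t\<ge>0. prob_kernel (P t)) \<and>
     (\<forall>f\<in>Mb. kernel_op (P 0) f = f) \<and>
     (\<forall>s\<ge>0. \<forall>t\<ge>0. \<forall>f\<in>Mb. kernel_op (P (s + t)) f = kernel_op (P s) (kernel_op (P t) f))"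

definition one_step_operators :: "(real \<Rightarrow> real ^ 'd::finite \<Rightarrow> (real ^ 'd) measure) \<Rightarrow> bool" where
  "one_step_operators Q \<longleftrightarrow>
     (\<forall>h>0. prob_kernel (Q h) \<and> (\<forall>f\<in>Cb_inf. kernel_op (Q h) f \<in> Cb_inf))"

definition invariant_prob ::
  "(real \<Rightarrow> real ^ 'd::finite \<Rightarrow> (real ^ 'd) measure) \<Rightarrow> (real ^ 'd) measure \<Rightarrow> bool" where
  "invariant_prob P \<nu> \<longleftrightarrow>
     prob_space \<nu> \<and> sets \<nu> = sets borel \<and>
     (\<forall>t\<ge>0. \<forall>f\<in>Mb. (\<integral>x. kernel_op (P t) f x \<partial>\<nu>) = (\<integral>x. f x \<partial>\<nu>))"

definition tv_dist :: "(real ^ 'd::finite) measure \<Rightarrow> (real ^ 'd) measure \<Rightarrow> ennreal" where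
  "tv_dist \<mu> \<nu> =
     (SUP f\<in>{f \<in> borel_measurable borel. sup_norm f \<le> 1}.
        ennreal \<bar>(\<integral>x. f x \<partial>\<mu>) - (\<integral>x. f x \<partial>\<nu>)\<bar>)"

section \<open>Decreasing time grid and Euler scheme\<close>

text \<open>Step sequences are indexed from 1; the value \<open>\<gamma> 0\<close> is never used.\<close>

definition Gam :: "(nat \<Rightarrow> real) \<Rightarrow> nat \<Rightarrow> real" where
  "Gam \<gamma> n = (\<Sum>i=1..n. \<gamma> i)"

definition omega_limsup :: "(nat \<Rightarrow> real) \<Rightarrow> ereal" where
  "omega_limsup \<gamma> = limsup (\<lambda>n. ereal ((\<gamma> n - \<gamma> (Suc n)) / (\<gamma> (Suc n))\<^sup>2))"

definition omega_bar :: "(nat \<Rightarrow> real) \<Rightarrow> real" where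
  "omega_bar \<gamma> = real_of_ereal (omega_limsup \<gamma>)"

definition step_sequence :: "(nat \<Rightarrow> real) \<Rightarrow> bool" where
  "step_sequence \<gamma> \<longleftrightarrow>
     (\<forall>n\<ge>1. 0 < \<gamma> n) \<and> (\<forall>n\<ge>1. \<gamma> (Suc n) \<le> \<gamma> n) \<and> \<gamma> \<longlonglongrightarrow> 0 \<and>
     filterlim (Gam \<gamma>) at_top sequentially \<and> omega_limsup \<gamma> < \<infinity>"

text \<open>Well defined for \<open>t \<ge> 0\<close> only.\<close>

definition Nidx :: "(nat \<Rightarrow> real) \<Rightarrow> real \<Rightarrow> nat" where
  "Nidx \<gamma> t = (THE i. Gam \<gamma> i \<le> t \<and> t < Gam \<gamma> (Suc i))"

text \<open>The kernel of the composition
  \<open>Q \<gamma>\<^bsub>N(s)+1\<^esub> \<circ> \<dots> \<circ> Q \<gamma>\<^bsub>N(t)\<^esub>\<close>; see the lemma \<open>kernel_op_euler\<close> below.\<close>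

definition euler ::
  "(real \<Rightarrow> real ^ 'd::finite \<Rightarrow> (real ^ 'd) measure) \<Rightarrow> (nat \<Rightarrow> real) \<Rightarrow>
     real \<Rightarrow> real \<Rightarrow> real ^ 'd \<Rightarrow> (real ^ 'd) measure" where
  "euler Q \<gamma> s t =
     foldr (\<lambda>i K x. Q (\<gamma> i) x \<bind> K) [Suc (Nidx \<gamma> s)..<Suc (Nidx \<gamma> t)] (return borel)"

lemma prob_kernel_bind:
  assumes "prob_kernel K" "prob_kernel L"
  shows "prob_kernel (\<lambda>x. K x \<bind> L)"
  using assms unfolding prob_kernel_def
  by (intro measurable_bind_prob_space2[where N = borel]) auto

lemma kernel_op_bind:
  assumes "prob_kernel K" "prob_kernel L" "f \<in> Mb"
  shows "kernel_op (\<lambda>x. K x \<bind> L) f = kernel_op K (kernel_op L f)"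
proof
  fix x
  from assms(3) obtain B where B: "\<And>y. \<bar>f y\<bar> \<le> B"
    unfolding Mb_def bounded_iff by auto
  have K: "K x \<in> space (prob_algebra borel)"
    using assms(1) unfolding prob_kernel_def by (auto dest: measurable_space)
  then interpret prob_space "K x" by (simp add: space_prob_algebra)
  have sK: "sets (K x) = sets borel" using K by (simp add: space_prob_algebra)
  have L: "L \<in> K x \<rightarrow>\<^sub>M subprob_algebra borel"
    using measurable_prob_algebraD[of L borel borel] assms(2) sK
    unfolding prob_kernel_def by (simp cong: measurable_cong_sets)
  have "(\<integral>y. f y \<partial>(K x \<bind> L)) = (\<integral>z. (\<integral>y. f y \<partial>L z) \<partial>K x)"
    using assms(3)
    by (intro integral_bind[where K = borel and B = B and B' = 1] L)
       (auto simp: Mb_def B not_empty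
         intro!: AE_I2 subprob_space.emeasure_space_le_1 subprob_space_kernel[OF L])
  then show "kernel_op (\<lambda>x. K x \<bind> L) f x = kernel_op K (kernel_op L f) x"
    by (simp add: kernel_op_def)
qed

lemma kernel_op_euler:
  assumes "one_step_operators Q" "\<forall>n\<ge>1. 0 < \<gamma> n" "f \<in> Mb"
  shows "kernel_op (euler Q \<gamma> s t) f =
    foldr (\<lambda>i. kernel_op (Q (\<gamma> i))) [Suc (Nidx \<gamma> s)..<Suc (Nidx \<gamma> t)] f"
proof -
  let ?k = "\<lambda>is. foldr (\<lambda>i K x. Q (\<gamma> i) x \<bind> K) is (return borel)"
  have "prob_kernel (?k is) \<and> kernel_op (?k is) f = foldr (\<lambda>i. kernel_op (Q (\<gamma> i))) is f"
    if "\<forall>i\<in>set is. 1 \<le> i" for "is"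
    using that
  proof (induction "is")
    case Nil
    have "f \<in> borel_measurable borel" using assms(3) by (simp add: Mb_def)
    then show ?case
      by (auto simp: prob_kernel_def kernel_op_def integral_return measurable_return_prob_space)
  next
    case (Cons i "is")
    then have "prob_kernel (Q (\<gamma> i))"
      using assms(1,2) by (auto simp: one_step_operators_def)
    with Cons show ?case
      using assms(3) by (auto intro: prob_kernel_bind simp: kernel_op_bind)
  qed
  from this[of "[Suc (Nidx \<gamma> s)..<Suc (Nidx \<gamma> t)]"] show ?thesis
    unfolding euler_def by (simp del: upt_Suc)
qed

section \<open>Super kernels\<close>

definition schwartz :: "(real ^ 'd::finite \<Rightarrow> real) \<Rightarrow> bool" where
  "schwartz \<phi> \<longleftrightarrow>
     (\<forall>l. times_differentiable l \<phi>) \<and>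
     (\<forall>m b. bounded (range (\<lambda>y. norm y ^ m * mpartial b \<phi> y)))"

definition super_kernel :: "(real ^ 'd::finite \<Rightarrow> real) \<Rightarrow> bool" where
  "super_kernel \<phi> \<longleftrightarrow>
     schwartz \<phi> \<and>
     (\<integral>y. \<phi> y \<partial>lborel) = 1 \<and>
     (\<forall>a. mdeg a \<ge> 1 \<longrightarrow> (\<integral>y. mpower y a * \<phi> y \<partial>lborel) = 0) \<and>
     (\<forall>m b. integrable lborel (\<lambda>y. norm y ^ m * \<bar>mpartial b \<phi> y\<bar>))"

definition rescale :: "(real ^ 'd::finite \<Rightarrow> real) \<Rightarrow> real \<Rightarrow> real ^ 'd \<Rightarrow> real" where
  "rescale \<phi> \<delta> y = \<phi> (y /\<^sub>R \<delta>) / \<delta> ^ CARD('d)"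

definition regularize ::
  "(real ^ 'd::finite \<Rightarrow> real) \<Rightarrow> real \<Rightarrow> (real ^ 'd \<Rightarrow> real) \<Rightarrow> real ^ 'd \<Rightarrow> real" where
  "regularize \<phi> \<delta> f x = (\<integral>y. f y * rescale \<phi> \<delta> (x - y) \<partial>lborel)"

end

theory Submission
  imports Defs "HOL-Real_Asymp.Real_Asymp"
begin

text \<open>
  Telescope \<open>Q\<^bsub>0,\<Gamma>\<^sub>n\<^esub> - P\<^bsub>0,\<Gamma>\<^sub>n\<^esub>\<close> into one-step errors
  \<open>Q \<circ> (Q\<^bsub>\<gamma>\<^sub>i\<^esub> - P\<^bsub>\<gamma>\<^sub>i\<^esub>) \<circ> P\<^bsub>\<Gamma>\<^sub>i,\<Gamma>\<^sub>n\<^esub>\<close>. While at least one unit of time remains,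
  \<open>P\<^bsub>\<Gamma>\<^sub>i,\<Gamma>\<^sub>n\<^esub>\<close> smooths a merely bounded function and the gradient decays like
  \<open>exp (- \<rho> (\<Gamma>\<^sub>n - \<Gamma>\<^sub>i))\<close>, so these errors sum to \<open>O(\<gamma>\<^sub>n\<^sup>\<alpha>)\<close>. On the last unit of time the function is
  replaced by its mollification \<open>f\<^sub>\<delta>\<close>, whose derivatives cost only a power of \<open>1/\<delta>\<close>; with
  \<open>\<delta>\<close> and \<open>\<eta>\<close> small powers of \<open>\<gamma>\<^sub>n\<close>, both this loss and the mollification error are absorbed by
  \<open>\<gamma>\<^sub>n\<^bsup>-\<epsilon>\<^esup>\<close>. Only large \<open>n\<close> need this argument, since the constant may absorb finitely many \<open>n\<close>.
  The gradient decay also makes \<open>P\<^sub>t f\<close> asymptotically constant, which gives uniqueness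
  of the invariant measure and the total variation estimate.
\<close>

section \<open>Iterated partial derivatives\<close>

text \<open>The cut one unit before the end is forced by the hypotheses: bounded functions are known
  to become smooth only from time 1 on, while the one-step estimate applies only to differentiable
  functions. Closer to the end, \<open>P\<close> merely preserves smoothness that is already there,
  hence the mollification. Replacing f by its mollification is cheap only behind a further unit of
  Euler steps, so the argument runs over three grid points \<Gamma>_j, \<Gamma>_m, \<Gamma>_n whose
  consecutive gaps lie in [1,2). All steps from j to n are bounded by a constant multiple of
  \<gamma>_n, which turns powers of intermediate steps into powers of \<gamma>_n. On the analytic
  side, the norms run over multi-indices in one fixed order of the coordinates, whereas calculus
  produces derivatives in arbitrary order; derivatives are therefore handled as words of
  coordinates, and symmetry is invoked only for the kernel.\<close>

lemma has_derivative_partials: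
  fixes f :: "real ^ 'd::finite \<Rightarrow> 'b::real_normed_vector"
  assumes "f differentiable (at x)"
  shows "(f has_derivative (\<lambda>h. \<Sum>i\<in>UNIV. h $ i *\<^sub>R partial i f x)) (at x)"
proof -
  let ?D = "frechet_derivative f (at x)"
  have D: "(f has_derivative ?D) (at x)"
    using assms frechet_derivative_works by blast
  then interpret D: bounded_linear ?D
    by (rule has_derivative_bounded_linear)
  have "?D h = (\<Sum>i\<in>UNIV. h $ i *\<^sub>R partial i f x)" for h
  proof -
    have "?D h = ?D (\<Sum>i\<in>UNIV. h $ i *\<^sub>R axis i 1)"
      using basis_expansion[of h] by (simp add: scalar_mult_eq_scaleR)
    also have "\<dots> = (\<Sum>i\<in>UNIV. h $ i *\<^sub>R partial i f x)"
      by (simp add: D.sum D.scaleR partial_def)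
    finally show ?thesis .
  qed
  then have "?D = (\<lambda>h. \<Sum>i\<in>UNIV. h $ i *\<^sub>R partial i f x)" by blast
  then show ?thesis using D by simp
qed

text \<open>The derivatives computed below come in coordinate form; uniqueness of the Frechet
  derivative then yields every partial by evaluation on a basis vector.\<close>

lemma partial_eqI:
  "(f has_derivative (\<lambda>h. \<Sum>i\<in>UNIV. h $ i *\<^sub>R D i)) (at x) \<Longrightarrow> partial j f x = D j"
  unfolding partial_def
  by (subst frechet_derivative_at[symmetric], assumption)
     (simp add: axis_def if_distrib[of "\<lambda>c. c *\<^sub>R _"] cong: if_cong)

lemma has_vector_derivative_line:
  fixes f :: "real ^ 'd::finite \<Rightarrow> 'b::real_normed_vector"
  assumes "f differentiable (at (x + s *\<^sub>R h))"
  shows "((\<lambda>s. f (x + s *\<^sub>R h)) has_vector_derivative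
    (\<Sum>i\<in>UNIV. h $ i *\<^sub>R partial i f (x + s *\<^sub>R h))) (at s)"
proof -
  have "((\<lambda>s. f (x + s *\<^sub>R h)) has_derivative
    (\<lambda>t. \<Sum>i\<in>UNIV. (t *\<^sub>R h) $ i *\<^sub>R partial i f (x + s *\<^sub>R h))) (at s)"
    by (rule has_derivative_compose[where f = "\<lambda>s. x + s *\<^sub>R h" and f' = "\<lambda>t. t *\<^sub>R h"])
       (auto intro!: derivative_eq_intros has_derivative_partials assms)
  then show ?thesis
    unfolding has_vector_derivative_def by (simp add: scaleR_sum_right)
qed

lemma partial_vec:
  fixes g :: "'n::finite \<Rightarrow> real ^ 'd::finite \<Rightarrow> real"
  assumes "\<And>i. g i differentiable (at x)"
  shows "partial j (\<lambda>x. \<chi> i. g i x) x = (\<chi> i. partial j (g i) x)"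
    and "(\<lambda>x. \<chi> i. g i x) differentiable (at x)"
proof -
  have d: "((\<lambda>x. \<chi> i. g i x) has_derivative
    (\<lambda>h. \<Sum>k\<in>UNIV. h $ k *\<^sub>R (\<chi> i. partial k (g i) x))) (at x)"
  proof -
    \<comment> \<open>Expanding the vector in the standard basis reduces the claim to scalar
      functions times constant vectors.\<close>
    have "((\<lambda>x. \<Sum>i\<in>UNIV. g i x *\<^sub>R axis i 1) has_derivative
      (\<lambda>h. \<Sum>i\<in>UNIV. (\<Sum>k\<in>UNIV. h $ k *\<^sub>R partial k (g i) x) *\<^sub>R (axis i 1 :: real ^ 'n))) (at x)"
      by (intro has_derivative_sum has_derivative_scaleR_left has_derivative_partials assms)
    moreover have "(\<lambda>x. \<Sum>i\<in>UNIV. g i x *\<^sub>R axis i 1) = (\<lambda>x. \<chi> i. g i x)"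
      by (auto simp: vec_eq_iff axis_def if_distrib cong: if_cong)
    moreover have "(\<lambda>h. \<Sum>i\<in>UNIV. (\<Sum>k\<in>UNIV. h $ k *\<^sub>R partial k (g i) x) *\<^sub>R (axis i 1 :: real ^ 'n))
       = (\<lambda>h. \<Sum>k\<in>UNIV. h $ k *\<^sub>R (\<chi> i. partial k (g i) x))"
      by (auto simp: vec_eq_iff axis_def if_distrib cong: if_cong)
    ultimately show ?thesis by simp
  qed
  show "partial j (\<lambda>x. \<chi> i. g i x) x = (\<chi> i. partial j (g i) x)"
    by (rule partial_eqI[OF d])
  show "(\<lambda>x. \<chi> i. g i x) differentiable (at x)"
    using d unfolding differentiable_def by blast
qed

text \<open>\<open>foldr partial\<close> applies the last letter of a word first, and the recursion
  of \<open>times_differentiable\<close> also strips the innermost derivative; the two match when a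
  letter is removed at the right end. In word form the innermost and the outermost derivative are
  equally accessible.\<close>

lemma times_differentiable_iff:
  fixes f :: "real ^ 'd::finite \<Rightarrow> 'b::real_normed_vector"

  shows "times_differentiable l f \<longleftrightarrow> (\<forall>is. length is < l \<longrightarrow> (\<forall>x. foldr partial is f differentiable (at x)))"
proof (induction l arbitrary: f)
  case (Suc l)
  have "(\<forall>is. length is < Suc l \<longrightarrow> (\<forall>x. foldr partial is f differentiable (at x))) \<longleftrightarrow>
    (\<forall>x. f differentiable (at x)) \<and>
    (\<forall>i is. length is < l \<longrightarrow> (\<forall>x. foldr partial is (partial i f) differentiable (at x)))"
    (is "?L \<longleftrightarrow> ?R")
  proof
    assume L: ?L
    have "foldr partial is (partial i f) differentiable (at x)" if "length is < l" for i "is" x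
      using L[rule_format, of "is @ [i]" x] that by simp
    moreover have "f differentiable (at x)" for x using L[rule_format, of "[]"] by simp
    ultimately show ?R by blast
  next
    assume R: ?R
    show ?L
    proof (intro allI impI)
      fix "is" :: "'d list" and x assume "length is < Suc l"
      then show "foldr partial is f differentiable (at x)"
        using R by (cases "is" rule: rev_cases) auto
    qed
  qed
  with Suc show ?case by auto
qed simp

lemma times_differentiable_foldr:
  fixes f :: "real ^ 'd::finite \<Rightarrow> 'b::real_normed_vector"

  shows "times_differentiable (length is + l) f \<Longrightarrow> times_differentiable l (foldr partial is f)"
  unfolding times_differentiable_iff
proof (intro allI impI)
  fix js :: "'d list" and x assume a: "\<forall>js. length js < length is + l \<longrightarrow> (\<forall>x. foldr partial js f differentiable (at x))"
    and l: "length js < l"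
  show "foldr partial js (foldr partial is f) differentiable (at x)"
    using a[rule_format, of "js @ is" x] l by simp
qed

text \<open>The gradient is the innermost derivative, so it contributes one letter at the right end
  of the word. This translates bounds on the vector-valued derivatives of \<open>grad f\<close> into
  bounds on scalar derivatives of f and back.\<close>

lemma foldr_partial_grad:
  assumes "times_differentiable (Suc (length is)) f"
  shows "foldr partial is (grad f) = (\<lambda>x. \<chi> i. foldr partial (is @ [i]) f x)"
  using assms
proof (induction "is")
  case Nil
  then show ?case by (simp add: grad_def fun_eq_iff)
next
  case (Cons j js)
  have "times_differentiable (Suc (length js)) f"
    using Cons.prems unfolding times_differentiable_iff by simp
  note IH = Cons.IH[OF this]
  have "foldr partial (js @ [i]) f differentiable (at x)" for i x
    using Cons.prems[unfolded times_differentiable_iff, rule_format, of "js @ [i]" x] by simp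
  then show ?case
    by (auto simp: IH fun_eq_iff intro!: partial_vec)
qed

section \<open>Multi-indices as words of coordinates\<close>

definition mword :: "('d::finite \<Rightarrow> nat) \<Rightarrow> 'd list" where
  "mword a = concat (map (\<lambda>i. replicate (a i) i) coords)"

lemma distinct_coords: "distinct (coords :: 'd::finite list)"
  and set_coords: "set (coords :: 'd::finite list) = UNIV"
  using someI_ex[OF finite_distinct_list[OF finite[of "UNIV :: 'd set"]]]
  unfolding coords_def conj_commute[of "distinct _"] by blast+

lemma mpartial_mword: "mpartial a f = foldr partial (mword a) f"
proof -
  have "foldr (\<lambda>i. partial i ^^ a i) is f = foldr partial (concat (map (\<lambda>i. replicate (a i) i) is)) f"
    for "is"
    by (induction "is") (auto simp: foldr_replicate)
  then show ?thesis by (simp add: mpartial_def mword_def)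
qed

lemma length_mword: "length (mword a) = mdeg a"
  by (simp add: mword_def length_concat mdeg_def o_def sum_list_distinct_conv_sum_set
      distinct_coords set_coords)

lemma count_mset_mword: "count (mset (mword a)) i = a i"
proof -
  have "count (mset (concat (map (\<lambda>i. replicate (a i) i) is))) i = (if i \<in> set is then a i else 0)"
    if "distinct is" for "is"
    using that by (induction "is") auto
  then show ?thesis by (simp add: mword_def distinct_coords set_coords)
qed

text \<open>Deleting the last letter of a word sorted along \<open>coords\<close> shortens its last
  nonempty block, so the result is again the word of a multi-index. Hence a derivative of order at
  least one is a component of a derivative of the gradient, without any reordering.\<close>

lemma mword_snocD:
  assumes "mword a = w @ [i]"
  obtains b where "w = mword b" "mdeg a = Suc (mdeg b)"
proof -
  \<comment> \<open>Stated for any distinct list so that blocks can be stripped from the right;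
    distinctness keeps the update of \<open>a\<close> away from the earlier blocks.\<close>
  have "w = concat (map (\<lambda>j. replicate ((a(i := a i - 1)) j) j) is)"
    if "distinct is" "concat (map (\<lambda>j. replicate (a j) j) is) = w @ [i]" for "is" w
    using that
  proof (induction "is" arbitrary: w rule: rev_induct)
    case (snoc j js)
    show ?case
    proof (cases "a j")
      case 0
      then have e: "concat (map (\<lambda>j. replicate (a j) j) js) = w @ [i]" using snoc.prems by simp
      have "i \<in> set js" using arg_cong[OF e, of set] by auto
      with snoc.prems have "i \<noteq> j" by auto
      with 0 e snoc show ?thesis by auto
    next
      case (Suc k)
      have r: "replicate (a j) j = replicate k j @ [j]"
        unfolding Suc by (simp add: replicate_append_same)
      have "i = j" "concat (map (\<lambda>j. replicate (a j) j) js) @ replicate k j = w"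
        using snoc.prems(2) by (auto simp: r simp del: append_assoc simp: append_assoc[symmetric])
      moreover have "map (\<lambda>i. replicate ((a(j := a j - 1)) i) i) js = map (\<lambda>i. replicate (a i) i) js"
        using snoc.prems(1) by auto
      ultimately show ?thesis using Suc by (simp del: map_eq_conv)
    qed
  qed simp
  from this[OF distinct_coords assms[unfolded mword_def]]
  have w: "w = mword (a(i := a i - 1))" by (simp add: mword_def)
  have "mdeg a = Suc (mdeg (a(i := a i - 1)))"
    using arg_cong[OF assms, of length] w by (simp add: length_mword)
  with w show thesis by (rule that)
qed

lemma finite_mdeg: "finite {a :: 'd::finite \<Rightarrow> nat. mdeg a \<le> k}"
proof (rule finite_subset)
  have "a i \<le> mdeg a" for a :: "'d \<Rightarrow> nat" and i
    unfolding mdeg_def by (rule member_le_sum) auto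
  then show "{a. mdeg a \<le> k} \<subseteq> PiE UNIV (\<lambda>_::'d. {..k})"
    by (auto intro: order_trans)
qed (auto intro: finite_PiE)

section \<open>Supremum norms and the classes \<open>Cb\<close>\<close>

lemma sup_norm_le_iff: "0 \<le> c \<Longrightarrow> sup_norm f \<le> ennreal c \<longleftrightarrow> (\<forall>x. norm (f x) \<le> c)"
  by (auto simp: sup_norm_def SUP_le_iff)

lemma sup_norm_le_Ck_norm: "mdeg a \<le> k \<Longrightarrow> sup_norm (mpartial a f) \<le> Ck_norm k f"
  unfolding Ck_norm_def by (rule member_le_sum) (auto simp: finite_mdeg)

lemma mpartial_zero:
  fixes f :: "real ^ 'd::finite \<Rightarrow> 'b::real_normed_vector"
  shows "mpartial (\<lambda>_. 0) f = f"
proof -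
  have "mword (\<lambda>_::'d. 0) = []"
    using length_mword[of "\<lambda>_::'d. 0"] by (simp add: mdeg_def)
  then show ?thesis by (simp add: mpartial_mword)
qed

lemma Ck_norm_0: "Ck_norm 0 f = sup_norm f"
proof -
  have "{a :: 'a \<Rightarrow> nat. mdeg a \<le> 0} = {\<lambda>_. 0}" by (auto simp: mdeg_def)
  then show ?thesis by (simp add: Ck_norm_def mpartial_zero)
qed

lemma sup_norm_le_Ck_norm_zero: "sup_norm f \<le> Ck_norm k f"
  using sup_norm_le_Ck_norm[of "\<lambda>_. 0" k f] by (simp add: mpartial_zero mdeg_def)

lemma Ck_norm_finite_iff: "Ck_norm k f < \<top> \<longleftrightarrow> (\<forall>a. mdeg a \<le> k \<longrightarrow> sup_norm (mpartial a f) < \<top>)"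
  by (auto simp: Ck_norm_def finite_mdeg)

lemma sup_norm_finite_iff: "sup_norm f < \<top> \<longleftrightarrow> bounded (range f)"
proof
  assume "sup_norm f < \<top>"
  then obtain c where "0 \<le> c" "sup_norm f = ennreal c" by (cases "sup_norm f") auto
  then have "\<forall>x. norm (f x) \<le> c" using sup_norm_le_iff[of c f] by auto
  then show "bounded (range f)" by (auto simp: bounded_iff)
next
  assume "bounded (range f)"
  then obtain c where "0 < c" "\<And>x. norm (f x) \<le> c" unfolding bounded_pos by auto
  then have "sup_norm f \<le> ennreal c" by (subst sup_norm_le_iff) auto
  then show "sup_norm f < \<top>" using le_less_trans ennreal_less_top by fastforce
qed

text \<open>Estimates are assumed and proved for the gradient, while the one-step estimate asks for
  membership in \<open>Cb (Suc k)\<close>. Only order zero is missing from the gradient, and that is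
  boundedness of f.\<close>

lemma in_Cb_grad:
  assumes td: "times_differentiable (Suc k) f" and b: "bounded (range f)"
    and fin: "Ck_norm k (grad f) < \<top>"
  shows "f \<in> Cb (Suc k)"
proof -
  have "bounded (range (mpartial a f))" if a: "mdeg a \<le> Suc k" for a
  proof (cases "mword a" rule: rev_cases)
    case Nil
    then show ?thesis using b by (simp add: mpartial_mword)
  next
    case (snoc w i)
    then obtain c where w: "w = mword c" and c: "mdeg a = Suc (mdeg c)" by (rule mword_snocD)
    have "times_differentiable (Suc (length w)) f"
      using td a c unfolding w length_mword times_differentiable_iff by simp
    from foldr_partial_grad[OF this]
    have eq: "mpartial a f x = mpartial c (grad f) x $ i" for x
      by (simp add: mpartial_mword snoc flip: w)
    have "bounded (range (mpartial c (grad f)))"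
      using fin c a by (auto simp: Ck_norm_finite_iff sup_norm_finite_iff)
    then obtain B where "\<And>x. norm (mpartial c (grad f) x) \<le> B" by (auto simp: bounded_iff)
    then have "norm (mpartial a f x) \<le> B" for x
      unfolding eq using component_le_norm_cart order_trans by (metis real_norm_def)
    then show ?thesis by (auto simp: bounded_iff)
  qed
  with td show ?thesis by (auto simp: Cb_def Ck_norm_finite_iff sup_norm_finite_iff)
qed

lemma Cb_Suc_in_Mb:
  assumes "f \<in> Cb (Suc k)" shows "f \<in> Mb"
proof -
  have "\<forall>x. f differentiable (at x)" using assms by (simp add: Cb_def)
  then have "continuous_on UNIV f"
    by (simp add: differentiable_imp_continuous_within continuous_on_eq_continuous_within)
  moreover have "sup_norm f < \<top>"
    using assms sup_norm_le_Ck_norm_zero[of f "Suc k"] unfolding Cb_def by (auto intro: le_less_trans)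
  ultimately show ?thesis
    by (auto simp: Mb_def sup_norm_finite_iff intro: borel_measurable_continuous_onI)
qed

text \<open>The derivative at z acts as the inner product with \<open>grad f z\<close>, so
  Cauchy-Schwarz bounds its operator norm by the norm of the gradient.\<close>

lemma sup_norm_grad_lipschitz:
  assumes "\<And>x. f differentiable (at x)" "sup_norm (grad f) \<le> ennreal B" "0 \<le> B"
  shows "\<bar>f x - f y\<bar> \<le> B * dist x y"
proof -
  have "norm (f x - f y) \<le> B * norm (x - y)"
  proof (rule differentiable_bound[of UNIV])
    fix z :: "real ^ 'a"
    show "(f has_derivative (\<lambda>h. \<Sum>i\<in>UNIV. h $ i *\<^sub>R partial i f z)) (at z within UNIV)"
      by (rule has_derivative_partials) fact
    show "onorm (\<lambda>h. \<Sum>i\<in>UNIV. h $ i *\<^sub>R partial i f z) \<le> B"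
    proof (rule onorm_bound)
      fix h :: "real ^ 'a"
      have "norm (\<Sum>i\<in>UNIV. h $ i *\<^sub>R partial i f z) = \<bar>h \<bullet> grad f z\<bar>"
        by (simp add: inner_vec_def grad_def)
      also have "\<dots> \<le> norm h * norm (grad f z)" by (rule Cauchy_Schwarz_ineq2)
      also have "\<dots> \<le> norm h * B"
        using assms(2,3) by (intro mult_left_mono) (auto simp: sup_norm_le_iff)
      finally show "norm (\<Sum>i\<in>UNIV. h $ i *\<^sub>R partial i f z) \<le> B * norm h"
        by (simp add: mult.commute)
    qed fact
  qed auto
  then show ?thesis by (simp add: dist_norm)
qed

section \<open>Symmetry of partial derivatives and Taylor remainders\<close>

lemma has_real_derivative_axis:
  fixes f :: "real ^ 'd::finite \<Rightarrow> real"
  assumes "\<And>y. f differentiable (at y)"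
  shows "((\<lambda>s. f (x + s *\<^sub>R axis i 1)) has_real_derivative partial i f (x + s *\<^sub>R axis i 1)) (at s)"
  using has_vector_derivative_line[OF assms, where x = x and s = s and h = "axis i 1"]
  by (simp add: has_real_derivative_iff_has_vector_derivative axis_def if_distrib[of "\<lambda>c. c * _"] cong: if_cong)

text \<open>The mixed second difference over a square of side h is rewritten by two mean value
  theorems, in direction i and then in direction j.\<close>

lemma second_difference_mean_value:
  fixes f :: "real ^ 'd::finite \<Rightarrow> real"
  assumes f: "\<And>y. f differentiable (at y)" and fi: "\<And>y. partial i f differentiable (at y)"
    and h: "0 < h"
  obtains s t where "0 < s" "s < h" "0 < t" "t < h"
    "f (x + h *\<^sub>R axis i 1 + h *\<^sub>R axis j 1) - f (x + h *\<^sub>R axis i 1) - f (x + h *\<^sub>R axis j 1) + f x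
      = h\<^sup>2 * partial j (partial i f) (x + s *\<^sub>R axis i 1 + t *\<^sub>R axis j 1)"
proof -
  let ?i = "axis i 1 :: real ^ 'd" and ?j = "axis j 1 :: real ^ 'd"
  define g where "g s = f (x + h *\<^sub>R ?j + s *\<^sub>R ?i) - f (x + s *\<^sub>R ?i)" for s
  have g: "(g has_real_derivative
      partial i f (x + h *\<^sub>R ?j + s *\<^sub>R ?i) - partial i f (x + s *\<^sub>R ?i)) (at s)" for s
    unfolding g_def by (intro DERIV_diff has_real_derivative_axis f)
  from MVT2[OF h g] obtain s where s: "0 < s" "s < h"
    "g h - g 0 = h * (partial i f (x + h *\<^sub>R ?j + s *\<^sub>R ?i) - partial i f (x + s *\<^sub>R ?i))"
    by auto
  from MVT2[OF h has_real_derivative_axis[OF fi], of "x + s *\<^sub>R ?i" j] obtain t where t: "0 < t" "t < h"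
    "partial i f (x + s *\<^sub>R ?i + h *\<^sub>R ?j) - partial i f (x + s *\<^sub>R ?i)
      = h * partial j (partial i f) (x + s *\<^sub>R ?i + t *\<^sub>R ?j)"
    by auto
  have "g h - g 0 = h\<^sup>2 * partial j (partial i f) (x + s *\<^sub>R ?i + t *\<^sub>R ?j)"
    using s(3) t(3) by (simp add: power2_eq_square add.assoc add.commute[of "h *\<^sub>R ?j"])
  moreover have "g h - g 0 = f (x + h *\<^sub>R ?i + h *\<^sub>R ?j) - f (x + h *\<^sub>R ?i) - f (x + h *\<^sub>R ?j) + f x"
    by (simp add: g_def add.assoc add.commute[of "h *\<^sub>R ?j"])
  ultimately show thesis using that s t by metis
qed

text \<open>The mixed second difference is symmetric in i and j, so the two mixed partials share a
  value at points within 2h of x. Threefold differentiability makes them continuous, which lets h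
  tend to 0.\<close>

lemma partial_commute:
  fixes f :: "real ^ 'd::finite \<Rightarrow> real"
  assumes "times_differentiable 3 f"
  shows "partial i (partial j f) = partial j (partial i f)"
proof
  fix x
  note td = assms[unfolded times_differentiable_iff, rule_format]
  have d0: "f differentiable (at y)" and d1: "partial k f differentiable (at y)"
    and d2: "partial k (partial l f) differentiable (at y)" for k l y
    using td[of "[]"] td[of "[k]"] td[of "[k, l]"] by auto
  define h where "h n = inverse (real (Suc n))" for n
  have h0: "h n > 0" for n by (simp add: h_def)
  have "\<exists>p q. norm (p - x) \<le> 2 * h n \<and> norm (q - x) \<le> 2 * h n \<and>
      partial i (partial j f) p = partial j (partial i f) q" for n
  proof -
    obtain s t where st: "0 < s" "s < h n" "0 < t" "t < h n"
      "f (x + h n *\<^sub>R axis i 1 + h n *\<^sub>R axis j 1) - f (x + h n *\<^sub>R axis i 1) - f (x + h n *\<^sub>R axis j 1) + f x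
        = (h n)\<^sup>2 * partial j (partial i f) (x + s *\<^sub>R axis i 1 + t *\<^sub>R axis j 1)"
      using second_difference_mean_value[of f i "h n" x j] d0 d1 h0 by blast
    obtain s' t' where st': "0 < s'" "s' < h n" "0 < t'" "t' < h n"
      "f (x + h n *\<^sub>R axis j 1 + h n *\<^sub>R axis i 1) - f (x + h n *\<^sub>R axis j 1) - f (x + h n *\<^sub>R axis i 1) + f x
        = (h n)\<^sup>2 * partial i (partial j f) (x + s' *\<^sub>R axis j 1 + t' *\<^sub>R axis i 1)"
      using second_difference_mean_value[of f j "h n" x i] d0 d1 h0 by blast
    have "(h n)\<^sup>2 * partial j (partial i f) (x + s *\<^sub>R axis i 1 + t *\<^sub>R axis j 1)
        = (h n)\<^sup>2 * partial i (partial j f) (x + s' *\<^sub>R axis j 1 + t' *\<^sub>R axis i 1)"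
      using st(5) st'(5) by (simp only: add.commute[of "h n *\<^sub>R axis i 1"] add.assoc)
    moreover have "norm (x + s *\<^sub>R axis i 1 + t *\<^sub>R axis j 1 - x) \<le> 2 * h n"
      using norm_triangle_ineq[of "s *\<^sub>R axis i 1 :: real ^ 'd" "t *\<^sub>R axis j 1"] st by (simp add: add.assoc)
    moreover have "norm (x + s' *\<^sub>R axis j 1 + t' *\<^sub>R axis i 1 - x) \<le> 2 * h n"
      using norm_triangle_ineq[of "s' *\<^sub>R axis j 1 :: real ^ 'd" "t' *\<^sub>R axis i 1"] st' by (simp add: add.assoc)
    ultimately show ?thesis using h0[of n] by (metis less_irrefl mult_left_cancel zero_less_power)
  qed
  then obtain p q where pq: "norm (p n - x) \<le> 2 * h n" "norm (q n - x) \<le> 2 * h n"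
    "partial i (partial j f) (p n) = partial j (partial i f) (q n)" for n by metis
  have lim: "(\<lambda>n. 2 * h n) \<longlonglongrightarrow> 0"
    unfolding h_def using tendsto_mult_right_zero[OF LIMSEQ_inverse_real_of_nat, of 2] by simp
  have p: "p \<longlonglongrightarrow> x"
    by (rule Lim_null[THEN iffD2], rule Lim_null_comparison[OF _ lim]) (simp add: pq(1))
  have q: "q \<longlonglongrightarrow> x"
    by (rule Lim_null[THEN iffD2], rule Lim_null_comparison[OF _ lim]) (simp add: pq(2))
  have "(\<lambda>n. partial i (partial j f) (p n)) \<longlonglongrightarrow> partial i (partial j f) x"
    by (rule isCont_tendsto_compose[OF _ p]) (rule differentiable_imp_continuous_within[OF d2])
  moreover have "(\<lambda>n. partial j (partial i f) (q n)) \<longlonglongrightarrow> partial j (partial i f) x"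
    by (rule isCont_tendsto_compose[OF _ q]) (rule differentiable_imp_continuous_within[OF d2])
  ultimately show "partial i (partial j f) x = partial j (partial i f) x"
    by (simp add: pq(3) LIMSEQ_unique)
qed

text \<open>A word and the sorted word with the same letter counts are permutations of each other,
  and partials commute on smooth functions. Smoothness is the invariant of the permutation argument
  because it survives every derivative.\<close>

lemma foldr_partial_eq_mpartial:
  fixes f :: "real ^ 'd::finite \<Rightarrow> real"
  assumes smooth: "\<And>l. times_differentiable l f"
  obtains b where "foldr partial is f = mpartial b f" "mdeg b = length is"
proof -
  define b where "b = count (mset is)"
  have m: "mset (mword b) = mset is"
    by (rule multiset_eqI) (simp add: count_mset_mword b_def)
  have "fold partial (rev (mword b)) f = fold partial (rev is) f"
  proof (rule fold_permuted_eq[where P = "\<lambda>f. \<forall>l. times_differentiable l f"])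
    show "partial i (partial j g) = partial j (partial i g)" if "\<forall>l. times_differentiable l g"
      for i j and g :: "real ^ 'd \<Rightarrow> real"
      using that by (intro partial_commute) auto
    show "\<forall>l. times_differentiable l (partial i g)" if "\<forall>l. times_differentiable l g"
      for i and g :: "real ^ 'd \<Rightarrow> real"
      using that by (metis times_differentiable.simps(2))
  qed (use smooth m in auto)
  then have "foldr partial is f = mpartial b f"
    by (simp add: mpartial_mword foldr_conv_fold)
  moreover have "mdeg b = length is"
    using arg_cong[OF m, of size] by (simp add: length_mword)
  ultimately show thesis by (rule that)
qed

lemma abs_sum_component_mult_le:
  fixes h :: "real ^ 'd::finite"
  assumes "\<And>i. \<bar>g i\<bar> \<le> M"
  shows "\<bar>\<Sum>i\<in>UNIV. h $ i * g i\<bar> \<le> CARD('d) * (norm h * M)"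
proof -
  have "\<bar>\<Sum>i\<in>UNIV. h $ i * g i\<bar> \<le> (\<Sum>i\<in>(UNIV :: 'd set). norm h * M)"
    by (rule order_trans[OF sum_abs sum_mono])
       (auto simp: abs_mult intro!: mult_mono component_le_norm_cart assms)
  then show ?thesis by simp
qed

text \<open>The bound M is required only along the segment from x to x + h. This locality allows M
  to decay with x, which a global bound on second derivatives could not express.\<close>

lemma taylor_remainder:
  fixes f :: "real ^ 'd::finite \<Rightarrow> real" and M :: real
  assumes td: "times_differentiable 2 f"
    and M: "\<And>i j s. 0 \<le> s \<Longrightarrow> s \<le> 1 \<Longrightarrow> \<bar>partial i (partial j f) (x + s *\<^sub>R h)\<bar> \<le> M"
  shows "\<bar>f (x + h) - f x - (\<Sum>i\<in>UNIV. h $ i * partial i f x)\<bar> \<le> (real CARD('d))\<^sup>2 * M * (norm h)\<^sup>2"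
proof -
  note td = td[unfolded times_differentiable_iff, rule_format]
  have d0: "f differentiable (at y)" and d1: "partial k f differentiable (at y)" for k y
    using td[of "[]"] td[of "[k]"] by auto
  let ?v = "\<lambda>s. \<Sum>i\<in>UNIV. h $ i * partial i f (x + s *\<^sub>R h)"
  let ?w = "\<lambda>s. \<Sum>j\<in>UNIV. h $ j * (\<Sum>i\<in>UNIV. h $ i * partial i (partial j f) (x + s *\<^sub>R h))"
  have "((\<lambda>s. f (x + s *\<^sub>R h)) has_real_derivative ?v s) (at s)" for s
    using has_vector_derivative_line[OF d0, where x = x and s = s and h = h]
    by (simp add: has_real_derivative_iff_has_vector_derivative)
  from MVT2[of 0 1 "\<lambda>s. f (x + s *\<^sub>R h)", OF _ this]
  obtain \<xi> where \<xi>: "0 < \<xi>" "\<xi> < 1" "f (x + h) - f x = ?v \<xi>" by auto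
  have "((\<lambda>s. partial j f (x + s *\<^sub>R h)) has_real_derivative
      (\<Sum>i\<in>UNIV. h $ i * partial i (partial j f) (x + s *\<^sub>R h))) (at s)" for s j
    using has_vector_derivative_line[OF d1, where x = x and s = s and h = h]
    by (simp add: has_real_derivative_iff_has_vector_derivative)
  then have "(?v has_real_derivative ?w s) (at s)" for s
    by (intro DERIV_sum DERIV_cmult)
  from MVT2[OF \<xi>(1) this] obtain \<zeta> where \<zeta>: "0 < \<zeta>" "\<zeta> < \<xi>" "?v \<xi> - ?v 0 = \<xi> * ?w \<zeta>" by auto
  have "\<bar>?w \<zeta>\<bar> \<le> CARD('d) * (norm h * (CARD('d) * (norm h * M)))"
    by (intro abs_sum_component_mult_le M) (use \<xi> \<zeta> in auto)
  moreover have "\<bar>\<xi> * ?w \<zeta>\<bar> \<le> 1 * \<bar>?w \<zeta>\<bar>"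
    unfolding abs_mult using \<xi> by (intro mult_right_mono) auto
  moreover have "f (x + h) - f x - (\<Sum>i\<in>UNIV. h $ i * partial i f x) = \<xi> * ?w \<zeta>"
    using \<xi>(3) \<zeta>(3) by simp
  ultimately show ?thesis by (simp add: power2_eq_square algebra_simps)
qed

lemma has_derivative_quadratic_remainder:
  assumes "bounded_linear D"
    and K: "\<And>h. norm h \<le> 1 \<Longrightarrow> norm (F (x + h) - F x - D h) \<le> K * (norm h)\<^sup>2"
  shows "(F has_derivative D) (at x)"
  unfolding has_derivative_at
proof (intro conjI assms)
  show "(\<lambda>h. norm (F (x + h) - F x - D h) / norm h) \<midarrow>0\<rightarrow> 0"
  proof (rule Lim_null_comparison)
    have "\<forall>\<^sub>F h in at 0. norm h < 1 \<and> h \<noteq> (0 :: 'a)"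
      by (auto simp: eventually_at intro!: exI[of _ 1])
    then show "\<forall>\<^sub>F h in at 0. norm (norm (F (x + h) - F x - D h) / norm h) \<le> K * norm h"
    proof eventually_elim
      case (elim h)
      then show ?case using K[of h] by (simp add: divide_simps power2_eq_square)
    qed
    show "(\<lambda>h. K * norm h) \<midarrow>0\<rightarrow> 0" by (auto intro!: tendsto_eq_intros)
  qed
qed

text \<open>Up to a constant, the joint density of independent Cauchy variables. The product form
  makes it integrable by Fubini in every dimension d, and it dominates the radial function (1 +
  |x|^2)^(-d).\<close>

definition cauchy_weight :: "'a::euclidean_space \<Rightarrow> real" where
  "cauchy_weight x = (\<Prod>b\<in>Basis. inverse (1 + (x \<bullet> b)\<^sup>2))"

lemma integrable_cauchy_weight: "integrable lborel (cauchy_weight :: 'a::euclidean_space \<Rightarrow> real)"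
proof -
  interpret product_sigma_finite "\<lambda>b::'a. lborel :: real measure" by standard
  have i: "integrable lborel (\<lambda>x::real. inverse (1 + x^2))"
    using integrable_inverse_1_plus_square by (simp add: set_integrable_def einterval_def)
  have "integrable (\<Pi>\<^sub>M b\<in>Basis. lborel) (\<lambda>f. \<Prod>b\<in>(Basis :: 'a set). inverse (1 + (f b :: real)\<^sup>2))"
    by (rule product_integrable_prod[OF finite_Basis, where f = "\<lambda>_ x. inverse (1 + x\<^sup>2)"]) (rule i)
  then show ?thesis
    unfolding cauchy_weight_def[abs_def]
    by (subst lborel_eq, subst integrable_distr_eq) (auto simp: inner_sum_left_Basis)
qed

lemma cauchy_weight_ge: "inverse ((1 + (norm x)\<^sup>2) ^ DIM('a)) \<le> cauchy_weight (x :: 'a::euclidean_space)"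
proof -
  have "(\<Prod>b\<in>(Basis :: 'a set). inverse (1 + (norm x)\<^sup>2)) \<le> cauchy_weight x"
    unfolding cauchy_weight_def
    by (intro prod_mono conjI le_imp_inverse_le add_left_mono power_mono_even)
       (auto simp: Basis_le_norm add_pos_nonneg)
  then show ?thesis by (simp add: power_inverse)
qed

text \<open>With w = x + v, |x|^2 \<le> (|w| + 1)^2 \<le> 2 |w|^2 + 2, whence the factor 3.
  Uniformity in v lets one integrable weight control a function along a whole Taylor
  segment.\<close>

lemma cauchy_weight_dominates_shift:
  assumes "norm v \<le> 1"
  shows "inverse ((1 + (norm (x + v))\<^sup>2) ^ DIM('a)) \<le> 3 ^ DIM('a) * cauchy_weight (x :: 'a::euclidean_space)"
proof -
  let ?w = "x + v"
  have "norm x \<le> norm ?w + 1"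
    using norm_triangle_ineq4[of ?w v] assms by simp
  then have "(norm x)\<^sup>2 \<le> (norm ?w + 1)\<^sup>2" by (intro power_mono) auto
  also have "\<dots> \<le> 2 * (norm ?w)\<^sup>2 + 2"
    using sum_squares_bound[of "norm ?w" 1] by (simp add: power2_eq_square algebra_simps)
  finally have "1 + (norm x)\<^sup>2 \<le> 3 * (1 + (norm ?w)\<^sup>2)"
    using zero_le_power2[of "norm ?w"] unfolding distrib_left by linarith
  then have "(1 + (norm x)\<^sup>2) ^ DIM('a) \<le> (3 * (1 + (norm ?w)\<^sup>2)) ^ DIM('a)"
    by (intro power_mono) auto
  then have "inverse ((3 * (1 + (norm ?w)\<^sup>2)) ^ DIM('a)) \<le> inverse ((1 + (norm x)\<^sup>2) ^ DIM('a))"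
    by (intro le_imp_inverse_le) (auto simp: add_pos_nonneg)
  also have "\<dots> \<le> cauchy_weight x" by (rule cauchy_weight_ge)
  finally have le: "inverse (3 ^ DIM('a)) * inverse ((1 + (norm ?w)\<^sup>2) ^ DIM('a)) \<le> cauchy_weight x"
    by (simp only: power_mult_distrib inverse_mult_distrib)
  have "inverse ((1 + (norm ?w)\<^sup>2) ^ DIM('a))
      = 3 ^ DIM('a) * (inverse (3 ^ DIM('a)) * inverse ((1 + (norm ?w)\<^sup>2) ^ DIM('a)))"
    by simp
  also have "\<dots> \<le> 3 ^ DIM('a) * cauchy_weight x"
    by (rule mult_left_mono[OF le]) simp
  finally show ?thesis .
qed

lemma inverse_power_decay:
  fixes g :: "'a::euclidean_space \<Rightarrow> real"
  assumes "bounded (range g)" "bounded (range (\<lambda>y. norm y ^ (2 * n) * g y))"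
  obtains K where "0 \<le> K" "\<And>y. \<bar>g y\<bar> \<le> K * inverse ((1 + (norm y)\<^sup>2) ^ n)"
proof -
  obtain A B where A: "\<And>y. \<bar>g y\<bar> \<le> A" and B: "\<And>y. \<bar>norm y ^ (2 * n) * g y\<bar> \<le> B"
    using assms by (auto simp: bounded_iff)
  have "\<bar>g y\<bar> * (1 + (norm y)\<^sup>2) ^ n \<le> 2 ^ n * (A + B)" for y
  proof -
    \<comment> \<open>The power of the sum is at most 2^n times the power of a maximum, hence at
      most 2^n times the sum of two powers, each controlled by one of the two boundedness
      assumptions.\<close>
    have "(1 + (norm y)\<^sup>2) ^ n \<le> (2 * max 1 ((norm y)\<^sup>2)) ^ n" by (intro power_mono) auto
    also have "\<dots> = 2 ^ n * (max 1 ((norm y)\<^sup>2)) ^ n" by (simp add: power_mult_distrib)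
    also have "\<dots> \<le> 2 ^ n * (1 + norm y ^ (2 * n))"
      by (intro mult_left_mono) (auto simp: max_def power_mult)
    finally have "\<bar>g y\<bar> * (1 + (norm y)\<^sup>2) ^ n \<le> \<bar>g y\<bar> * (2 ^ n * (1 + norm y ^ (2 * n)))"
      by (intro mult_left_mono) auto
    also have "\<dots> = 2 ^ n * (\<bar>g y\<bar> + \<bar>norm y ^ (2 * n) * g y\<bar>)"
      by (simp add: abs_mult algebra_simps)
    also have "\<dots> \<le> 2 ^ n * (A + B)" by (intro mult_left_mono add_mono A B) auto
    finally show ?thesis .
  qed
  moreover have "(1 + (norm y)\<^sup>2) ^ n > 0" for y :: 'a by (simp add: add_pos_nonneg)
  ultimately have "\<bar>g y\<bar> \<le> (2 ^ n * (A + B)) * inverse ((1 + (norm y)\<^sup>2) ^ n)" for y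
    by (simp add: pos_le_divide_eq flip: divide_inverse)
  moreover have "0 \<le> A" "0 \<le> B" using A[of undefined] B[of undefined] by linarith+
  ultimately show thesis using that[of "2 ^ n * (A + B)"] by (simp add: zero_le_mult_iff)
qed

section \<open>Convolution with rapidly decaying kernels\<close>

lemma distr_lborel_reflect:
  "distr lborel borel (\<lambda>y. x - y) = (lborel :: 'a::euclidean_space measure)"
  using lborel_affine[of "-1" x] by (simp add: density_1)

lemma integrable_reflect:
  fixes g :: "'a::euclidean_space \<Rightarrow> real"
  assumes "integrable lborel g"
  shows "integrable lborel (\<lambda>y. g (x - y))"
    and "(\<integral>y. g (x - y) \<partial>lborel) = (\<integral>y. g y \<partial>lborel)"
proof -
  have [measurable]: "g \<in> borel_measurable borel"
    using borel_measurable_integrable[OF assms] by simp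
  show "integrable lborel (\<lambda>y. g (x - y))"
    using assms by (subst (asm) distr_lborel_reflect[of x, symmetric]) (simp add: integrable_distr_eq)
  show "(\<integral>y. g (x - y) \<partial>lborel) = (\<integral>y. g y \<partial>lborel)"
    by (subst (2) distr_lborel_reflect[of x, symmetric]) (simp add: integral_distr)
qed

text \<open>The Schwartz condition with words in place of multi-indices. In this form the class is
  closed under partial derivatives by appending words, with no reordering.\<close>

definition rapidly_decaying :: "(real ^ 'd::finite \<Rightarrow> real) \<Rightarrow> bool" where
  "rapidly_decaying \<psi> \<longleftrightarrow> (\<forall>l. times_differentiable l \<psi>) \<and>
     (\<forall>is m. bounded (range (\<lambda>y. norm y ^ m * foldr partial is \<psi> y)))"

lemma schwartz_rapidly_decaying:
  assumes "schwartz \<phi>" shows "rapidly_decaying \<phi>"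
  unfolding rapidly_decaying_def
proof (intro conjI allI)
  show td: "times_differentiable l \<phi>" for l using assms by (simp add: schwartz_def)
  show "bounded (range (\<lambda>y. norm y ^ m * foldr partial is \<phi> y))" for "is" m
  proof -
    obtain b where "foldr partial is \<phi> = mpartial b \<phi>"
      using td by (rule foldr_partial_eq_mpartial)
    then show ?thesis using assms by (simp add: schwartz_def)
  qed
qed

lemma rapidly_decaying_foldr:
  assumes "rapidly_decaying \<psi>" shows "rapidly_decaying (foldr partial is \<psi>)"
  unfolding rapidly_decaying_def
proof (intro conjI allI)
  show "times_differentiable l (foldr partial is \<psi>)" for l
    using assms by (intro times_differentiable_foldr) (simp add: rapidly_decaying_def)
  show "bounded (range (\<lambda>y. norm y ^ m * foldr partial js (foldr partial is \<psi>) y))" for js m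
    using assms[unfolded rapidly_decaying_def, THEN conjunct2, rule_format, of m "js @ is"] by simp
qed

lemma rapidly_decaying_partial: "rapidly_decaying \<psi> \<Longrightarrow> rapidly_decaying (partial i \<psi>)"
  using rapidly_decaying_foldr[of \<psi> "[i]"] by simp

lemma rapidly_decaying_differentiable: "rapidly_decaying \<psi> \<Longrightarrow> \<psi> differentiable (at x)"
  unfolding rapidly_decaying_def by (metis times_differentiable.simps(2))

lemma rapidly_decaying_weight:
  fixes \<psi> :: "real ^ 'd::finite \<Rightarrow> real"
  assumes "rapidly_decaying \<psi>"
  obtains K where "0 \<le> K" "\<And>y. \<bar>\<psi> y\<bar> \<le> K * inverse ((1 + (norm y)\<^sup>2) ^ CARD('d))"
proof -
  have "bounded (range (\<lambda>y. norm y ^ m * foldr partial [] \<psi> y))" for m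
    using assms unfolding rapidly_decaying_def by blast
  from this[of 0] this[of "2 * CARD('d)"]
  have "bounded (range \<psi>)" "bounded (range (\<lambda>y. norm y ^ (2 * CARD('d)) * \<psi> y))" by simp_all
  then show thesis by (rule inverse_power_decay[where n = "CARD('d)"]) (rule that)
qed

lemma rapidly_decaying_integrable:
  fixes \<psi> :: "real ^ 'd::finite \<Rightarrow> real"
  assumes "rapidly_decaying \<psi>" shows "integrable lborel \<psi>"
proof -
  obtain K where K: "0 \<le> K" "\<And>y. \<bar>\<psi> y\<bar> \<le> K * inverse ((1 + (norm y)\<^sup>2) ^ CARD('d))"
    using rapidly_decaying_weight[OF assms] by blast
  have "continuous_on UNIV \<psi>"
    using rapidly_decaying_differentiable[OF assms]
    by (simp add: differentiable_imp_continuous_within continuous_on_eq_continuous_within)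
  then have m: "\<psi> \<in> borel_measurable lborel"
    by (simp add: borel_measurable_continuous_onI)
  have b: "\<bar>\<psi> y\<bar> \<le> \<bar>K * cauchy_weight y\<bar>" for y
    using K(2)[of y] mult_left_mono[OF cauchy_weight_ge[of y] K(1)] by simp
  show ?thesis
    by (rule Bochner_Integration.integrable_bound[OF integrable_mult_right[OF integrable_cauchy_weight, of K] m])
       (simp add: b)
qed

text \<open>The second partials decay like a multiple of the weight, uniformly on unit balls, so the
  Taylor remainder is quadratic in h with a factor that is integrable in z. This replaces dominated
  convergence when differentiating under the integral.\<close>

lemma rapidly_decaying_remainder:
  fixes \<psi> :: "real ^ 'd::finite \<Rightarrow> real"
  assumes \<psi>: "rapidly_decaying \<psi>"
  obtains K where "0 \<le> K" "\<And>z h. norm h \<le> 1 \<Longrightarrow>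
    \<bar>\<psi> (z + h) - \<psi> z - (\<Sum>i\<in>UNIV. h $ i * partial i \<psi> z)\<bar> \<le> K * (norm h)\<^sup>2 * cauchy_weight z"
proof -
  have "\<exists>K\<ge>0. \<forall>y. \<bar>partial i (partial j \<psi>) y\<bar> \<le> K * inverse ((1 + (norm y)\<^sup>2) ^ CARD('d))" for i j
    using rapidly_decaying_weight[of "partial i (partial j \<psi>)"] \<psi> by (metis rapidly_decaying_partial)
  then obtain B where B: "\<And>i j. 0 \<le> B i j"
    "\<And>i j y. \<bar>partial i (partial j \<psi>) y\<bar> \<le> B i j * inverse ((1 + (norm y)\<^sup>2) ^ CARD('d))"
    by metis
  define C where "C = (\<Sum>i\<in>UNIV. \<Sum>j\<in>UNIV. B i j)"
  have BC: "B i j \<le> C" for i j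
    unfolding C_def
    by (rule order_trans[OF member_le_sum[of j UNIV "B i"] member_le_sum[of i UNIV "\<lambda>i. \<Sum>j\<in>UNIV. B i j"]])
       (auto simp: B sum_nonneg)
  have C0: "0 \<le> C" by (simp add: C_def B sum_nonneg)
  let ?K = "(real CARD('d))\<^sup>2 * (C * 3 ^ CARD('d))"
  show thesis
  proof (rule that)
    show "0 \<le> ?K" using C0 by simp
    fix z h :: "real ^ 'd" assume h: "norm h \<le> 1"
    have "\<bar>\<psi> (z + h) - \<psi> z - (\<Sum>i\<in>UNIV. h $ i * partial i \<psi> z)\<bar>
        \<le> (real CARD('d))\<^sup>2 * (C * (3 ^ CARD('d) * cauchy_weight z)) * (norm h)\<^sup>2"
    proof (rule taylor_remainder)
      show "times_differentiable 2 \<psi>" using \<psi> by (simp add: rapidly_decaying_def)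
      fix i j and s :: real assume s: "0 \<le> s" "s \<le> 1"
      have "norm (s *\<^sub>R h) \<le> 1" using s h by (simp add: mult_le_one)
      from cauchy_weight_dominates_shift[OF this, of z]
      have "inverse ((1 + (norm (z + s *\<^sub>R h))\<^sup>2) ^ CARD('d)) \<le> 3 ^ CARD('d) * cauchy_weight z" by simp
      moreover have "\<bar>partial i (partial j \<psi>) (z + s *\<^sub>R h)\<bar>
          \<le> C * inverse ((1 + (norm (z + s *\<^sub>R h))\<^sup>2) ^ CARD('d))"
        by (rule order_trans[OF B(2) mult_right_mono[OF BC]]) (simp add: add_nonneg_nonneg)
      ultimately show "\<bar>partial i (partial j \<psi>) (z + s *\<^sub>R h)\<bar> \<le> C * (3 ^ CARD('d) * cauchy_weight z)"
        using C0 by (meson mult_left_mono order_trans)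
    qed
    then show "\<bar>\<psi> (z + h) - \<psi> z - (\<Sum>i\<in>UNIV. h $ i * partial i \<psi> z)\<bar> \<le> ?K * (norm h)\<^sup>2 * cauchy_weight z"
      by (simp add: mult_ac)
  qed
qed

definition convolution :: "(real ^ 'd::finite \<Rightarrow> real) \<Rightarrow> (real ^ 'd \<Rightarrow> real) \<Rightarrow> real ^ 'd \<Rightarrow> real" where
  "convolution f \<psi> x = (\<integral>y. f y * \<psi> (x - y) \<partial>lborel)"

lemma integrable_bounded_mult:
  fixes f g :: "real ^ 'd::finite \<Rightarrow> real"
  assumes "f \<in> borel_measurable borel" "\<And>y. \<bar>f y\<bar> \<le> S" "integrable lborel g"
  shows "integrable lborel (\<lambda>y. f y * g y)" "\<bar>\<integral>y. f y * g y \<partial>lborel\<bar> \<le> S * (\<integral>y. \<bar>g y\<bar> \<partial>lborel)"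
proof -
  have b: "\<bar>f y * g y\<bar> \<le> S * \<bar>g y\<bar>" for y
    unfolding abs_mult by (intro mult_right_mono assms) auto
  have "0 \<le> S" using assms(2)[of undefined] by linarith
  note i = integrable_mult_right[OF integrable_abs[OF assms(3)], of S]
  have "AE y in lborel. norm (f y * g y) \<le> norm (S * \<bar>g y\<bar>)"
    using b \<open>0 \<le> S\<close> by (simp add: abs_mult)
  then show fg: "integrable lborel (\<lambda>y. f y * g y)"
    by (intro Bochner_Integration.integrable_bound[OF i] borel_measurable_times)
       (use assms in auto)
  have "\<bar>\<integral>y. f y * g y \<partial>lborel\<bar> \<le> (\<integral>y. \<bar>f y * g y\<bar> \<partial>lborel)"
    by (rule integral_abs_bound)
  also have "\<dots> \<le> (\<integral>y. S * \<bar>g y\<bar> \<partial>lborel)"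
    by (intro integral_mono integrable_abs fg i b)
  finally show "\<bar>\<integral>y. f y * g y \<partial>lborel\<bar> \<le> S * (\<integral>y. \<bar>g y\<bar> \<partial>lborel)" by simp
qed

context
  fixes f :: "real ^ 'd::finite \<Rightarrow> real" and S :: real
  assumes f: "f \<in> borel_measurable borel" and S: "\<And>y. \<bar>f y\<bar> \<le> S"
begin

lemma convolution_bound:
  assumes "rapidly_decaying \<psi>"
  shows "\<bar>convolution f \<psi> x\<bar> \<le> S * (\<integral>y. \<bar>\<psi> y\<bar> \<partial>lborel)"
proof -
  note i = rapidly_decaying_integrable[OF assms]
  have "(\<integral>y. \<bar>\<psi> (x - y)\<bar> \<partial>lborel) = (\<integral>y. \<bar>\<psi> y\<bar> \<partial>lborel)"
    by (rule integrable_reflect[OF integrable_abs[OF i]])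
  with integrable_bounded_mult(2)[OF f S integrable_reflect(1)[OF i, of x]] show ?thesis
    by (simp add: convolution_def)
qed

text \<open>Since f is merely measurable, the derivative falls on the kernel. The Taylor remainder
  of the kernel, integrated against f with |f| \<le> S, is at most S K W |h|^2, where W is the mass
  of the weight.\<close>

lemma has_derivative_convolution:
  assumes \<psi>: "rapidly_decaying \<psi>"
  shows "(convolution f \<psi> has_derivative (\<lambda>h. \<Sum>i\<in>UNIV. h $ i *\<^sub>R convolution f (partial i \<psi>) x)) (at x)"
proof -
  obtain K where K: "0 \<le> K" "\<And>z h. norm h \<le> 1 \<Longrightarrow>
    \<bar>\<psi> (z + h) - \<psi> z - (\<Sum>i\<in>UNIV. h $ i * partial i \<psi> z)\<bar> \<le> K * (norm h)\<^sup>2 * cauchy_weight z"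
    using rapidly_decaying_remainder[OF \<psi>] by blast
  define W where "W = (\<integral>y. \<bar>cauchy_weight (y :: real ^ 'd)\<bar> \<partial>lborel)"
  have S0: "0 \<le> S" using S[of undefined] by linarith
  show ?thesis
  proof (rule has_derivative_quadratic_remainder)
    show "bounded_linear (\<lambda>h. \<Sum>i\<in>UNIV. h $ i *\<^sub>R convolution f (partial i \<psi>) x)"
      by (intro bounded_linear_sum bounded_linear_scaleR_const bounded_linear_vec_nth)
    fix h :: "real ^ 'd" assume h: "norm h \<le> 1"
    let ?R = "\<lambda>y. \<psi> (x + h - y) - \<psi> (x - y) - (\<Sum>i\<in>UNIV. h $ i * partial i \<psi> (x - y))"
    have i1: "integrable lborel (\<lambda>y. \<psi> (z - y))" for z
      by (intro integrable_reflect rapidly_decaying_integrable \<psi>)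
    have i2: "integrable lborel (\<lambda>y. partial i \<psi> (x - y))" for i
      by (intro integrable_reflect rapidly_decaying_integrable rapidly_decaying_partial \<psi>)
    have iR: "integrable lborel ?R"
      by (intro Bochner_Integration.integrable_diff Bochner_Integration.integrable_sum integrable_mult_right i1 i2)
    have iW: "integrable lborel (\<lambda>y. cauchy_weight (x - y :: real ^ 'd))"
      by (rule integrable_reflect[OF integrable_cauchy_weight])
    have "(\<integral>y. f y * ?R y \<partial>lborel) = (\<integral>y. f y * \<psi> (x + h - y) - f y * \<psi> (x - y) -
        (\<Sum>i\<in>UNIV. h $ i * (f y * partial i \<psi> (x - y))) \<partial>lborel)"
      by (intro Bochner_Integration.integral_cong)
         (auto simp: right_diff_distrib sum_distrib_left mult.left_commute)
    also have "\<dots> = convolution f \<psi> (x + h) - convolution f \<psi> x -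
        (\<Sum>i\<in>UNIV. h $ i * convolution f (partial i \<psi>) x)"
      using integrable_bounded_mult(1)[OF f S i1] integrable_bounded_mult(1)[OF f S i2]
      by (simp add: convolution_def)
    finally have "\<bar>convolution f \<psi> (x + h) - convolution f \<psi> x -
        (\<Sum>i\<in>UNIV. h $ i * convolution f (partial i \<psi>) x)\<bar> \<le> S * (\<integral>y. \<bar>?R y\<bar> \<partial>lborel)"
      using integrable_bounded_mult(2)[OF f S iR] by simp
    also have "\<dots> \<le> S * (\<integral>y. K * (norm h)\<^sup>2 * \<bar>cauchy_weight (x - y)\<bar> \<partial>lborel)"
    proof (intro mult_left_mono integral_mono integrable_abs iR integrable_mult_right iW S0)
      fix y show "\<bar>?R y\<bar> \<le> K * (norm h)\<^sup>2 * \<bar>cauchy_weight (x - y)\<bar>"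
        using K(2)[OF h, of "x - y"] K(1)
        by (intro order_trans[OF _ mult_left_mono[OF abs_ge_self]]) (auto simp: algebra_simps)
    qed
    also have "\<dots> = S * K * W * (norm h)\<^sup>2"
      unfolding W_def
      using integrable_reflect(2)[OF integrable_abs[OF integrable_cauchy_weight], of x] by simp
    finally show "norm (convolution f \<psi> (x + h) - convolution f \<psi> x -
        (\<Sum>i\<in>UNIV. h $ i *\<^sub>R convolution f (partial i \<psi>) x)) \<le> S * K * W * (norm h)\<^sup>2" by simp
  qed
qed

lemma foldr_partial_convolution:
  assumes "rapidly_decaying \<psi>"
  shows "foldr partial is (convolution f \<psi>) = convolution f (foldr partial is \<psi>)"
proof (induction "is")
  case (Cons i "is")
  then show ?case
    using partial_eqI[OF has_derivative_convolution[OF rapidly_decaying_foldr[OF assms]]] by auto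
qed simp

lemma times_differentiable_convolution:
  assumes "rapidly_decaying \<psi>"
  shows "times_differentiable l (convolution f \<psi>)"
  unfolding times_differentiable_iff foldr_partial_convolution[OF assms] differentiable_def
  using has_derivative_convolution[OF rapidly_decaying_foldr[OF assms]] by blast

end

text \<open>The substitution y = \<delta> u moves the scale from the kernel into f and the argument,
  so convolutions need differentiating for the fixed kernel \<phi> only. The Jacobian cancels the
  factor in \<open>rescale\<close>.\<close>

lemma regularize_eq_convolution:
  fixes \<phi> f :: "real ^ 'd::finite \<Rightarrow> real"
  assumes \<delta>: "0 < \<delta>" and [measurable]: "f \<in> borel_measurable borel" "\<phi> \<in> borel_measurable borel"
  shows "regularize \<phi> \<delta> f x = convolution (\<lambda>u. f (\<delta> *\<^sub>R u)) \<phi> (x /\<^sub>R \<delta>)"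
proof -
  let ?M = "distr lborel borel (\<lambda>y. \<delta> *\<^sub>R y) :: (real ^ 'd) measure"
  let ?h = "\<lambda>y. f y * rescale \<phi> \<delta> (x - y)"
  have l: "density ?M (\<lambda>_. ennreal (\<delta> ^ CARD('d))) = lborel"
    using lborel_affine[of \<delta> "0 :: real ^ 'd", symmetric] \<delta> by (simp add: ennreal_power)
  have h: "?h \<in> borel_measurable borel"
    unfolding rescale_def by measurable
  have "(\<integral>y. ?h y \<partial>lborel) = (\<integral>y. ?h y \<partial>density ?M (\<lambda>_. ennreal (\<delta> ^ CARD('d))))"
    by (simp only: l)
  also have "\<dots> = (\<integral>y. \<delta> ^ CARD('d) *\<^sub>R ?h y \<partial>?M)"
    by (rule integral_density) (use h \<delta> in simp_all)
  also have "\<dots> = (\<integral>u. \<delta> ^ CARD('d) *\<^sub>R ?h (\<delta> *\<^sub>R u) \<partial>lborel)"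
    by (rule integral_distr) (use h in simp_all)
  also have "\<dots> = (\<integral>u. f (\<delta> *\<^sub>R u) * \<phi> (x /\<^sub>R \<delta> - u) \<partial>lborel)"
    using \<delta> by (intro Bochner_Integration.integral_cong) (auto simp: rescale_def scaleR_diff_right)
  finally show ?thesis by (simp add: regularize_def convolution_def)
qed

text \<open>The chain rule gives one factor c per letter; with c = 1/\<delta> this is the source of
  all negative powers of \<delta>.\<close>

lemma foldr_partial_scale:
  fixes g :: "real ^ 'd::finite \<Rightarrow> real"
  assumes "\<And>l. times_differentiable l g"
  shows "foldr partial is (\<lambda>x. g (c *\<^sub>R x)) = (\<lambda>x. c ^ length is * foldr partial is g (c *\<^sub>R x))"
    and "foldr partial is (\<lambda>x. g (c *\<^sub>R x)) differentiable (at x)"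
proof -
  have d: "((\<lambda>x. a * foldr partial is g (c *\<^sub>R x)) has_derivative
      (\<lambda>h. \<Sum>i\<in>UNIV. h $ i *\<^sub>R (a * (c * foldr partial (i # is) g (c *\<^sub>R x))))) (at x)" for "is" a x
  proof -
    have "foldr partial is g differentiable (at (c *\<^sub>R x))"
      using assms[of "Suc (length is)"] unfolding times_differentiable_iff by simp
    from has_derivative_partials[OF this]
    have "((\<lambda>x. foldr partial is g (c *\<^sub>R x)) has_derivative
      (\<lambda>h. \<Sum>i\<in>UNIV. (c *\<^sub>R h) $ i *\<^sub>R partial i (foldr partial is g) (c *\<^sub>R x))) (at x)"
      by (rule has_derivative_compose[where f = "\<lambda>x. c *\<^sub>R x" and f' = "\<lambda>h. c *\<^sub>R h", rotated])
        (auto intro!: derivative_eq_intros)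
    from has_derivative_mult_right[OF this, of a] show ?thesis
      by (simp add: sum_distrib_left mult_ac)
  qed
  show *: "foldr partial is (\<lambda>x. g (c *\<^sub>R x)) = (\<lambda>x. c ^ length is * foldr partial is g (c *\<^sub>R x))" for "is"
  proof (induction "is")
    case (Cons i "is")
    have "partial i (\<lambda>x. c ^ length is * foldr partial is g (c *\<^sub>R x)) =
       (\<lambda>x. c ^ length (i # is) * foldr partial (i # is) g (c *\<^sub>R x))"
      using partial_eqI[OF d[of "c ^ length is" "is"]] by (auto simp: mult_ac)
    with Cons show ?case by simp
  qed simp
  show "foldr partial is (\<lambda>x. g (c *\<^sub>R x)) differentiable (at x)"
    unfolding * using d unfolding differentiable_def by blast
qed

lemma regularize_grad_estimate:
  fixes \<phi> :: "real ^ 'd::finite \<Rightarrow> real"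
  assumes \<phi>: "schwartz \<phi>"
  obtains A where "0 \<le> A" and
    "\<And>f S \<delta>. f \<in> borel_measurable borel \<Longrightarrow> (\<And>y. \<bar>f y\<bar> \<le> S) \<Longrightarrow> 0 < \<delta> \<Longrightarrow> \<delta> \<le> 1 \<Longrightarrow>
      regularize \<phi> \<delta> f \<in> Cb (Suc k) \<and>
      Ck_norm k (grad (regularize \<phi> \<delta> f)) \<le> ennreal (A * S / \<delta> ^ Suc k)"
proof -
  define J where "J is = (\<integral>y. \<bar>foldr partial is \<phi> y\<bar> \<partial>lborel)" for "is"
  have J0: "0 \<le> J is" for "is" by (simp add: J_def)
  \<comment> \<open>\<open>A\<close> adds the L1 norms of derivatives of \<phi> of orders 1 to k +
    1, one for each word that occurs as a component of a derivative of a gradient.\<close>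
  define A where "A = (\<Sum>a | mdeg a \<le> k. \<Sum>i\<in>UNIV. J (mword a @ [i]))"
  note rd = schwartz_rapidly_decaying[OF \<phi>]
  show thesis
  proof (rule that)
    show "0 \<le> A" by (simp add: A_def J0 sum_nonneg)
    fix f :: "real ^ 'd \<Rightarrow> real" and S \<delta> :: real
    assume f[measurable]: "f \<in> borel_measurable borel" and S: "\<And>y. \<bar>f y\<bar> \<le> S" and \<delta>: "0 < \<delta>" "\<delta> \<le> 1"
    have S0: "0 \<le> S" using S[of undefined] by linarith
    define F where "F u = f (\<delta> *\<^sub>R u)" for u
    have F: "F \<in> borel_measurable borel" "\<And>y. \<bar>F y\<bar> \<le> S" unfolding F_def using S by auto
    define g where "g = convolution F \<phi>"
    define c where "c = inverse \<delta>"
    \<comment> \<open>This is where \<delta> \<le> 1 enters: derivatives of lower order cost at most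
      c^(k+1), the price of the highest one.\<close>
    have c: "1 \<le> c" using \<delta> by (simp add: c_def one_le_inverse)
    have "\<phi> \<in> borel_measurable borel"
      using borel_measurable_integrable[OF rapidly_decaying_integrable[OF rd]] by simp
    then have eq: "regularize \<phi> \<delta> f = (\<lambda>x. g (c *\<^sub>R x))"
      using regularize_eq_convolution[OF \<delta>(1) f] unfolding g_def F_def c_def by auto
    have tdg: "times_differentiable l g" for l
      unfolding g_def by (rule times_differentiable_convolution[OF F rd])
    note w = foldr_partial_scale[OF tdg, where c = c]
    have td: "times_differentiable l (regularize \<phi> \<delta> f)" for l
      unfolding times_differentiable_iff eq using w(2) by blast
    have bd: "\<bar>foldr partial is (regularize \<phi> \<delta> f) x\<bar> \<le> c ^ length is * (S * J is)" for "is" x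
    proof -
      have "\<bar>foldr partial is g (c *\<^sub>R x)\<bar> \<le> S * J is"
        unfolding g_def J_def foldr_partial_convolution[OF F rd]
        by (rule convolution_bound[OF F rapidly_decaying_foldr[OF rd]])
      then show ?thesis
        unfolding eq w(1) abs_mult using c by (intro mult_mono) auto
    qed
    have "sup_norm (mpartial a (grad (regularize \<phi> \<delta> f)))
        \<le> ennreal (c ^ Suc k * S * (\<Sum>i\<in>UNIV. J (mword a @ [i])))" if a: "mdeg a \<le> k" for a
    proof (subst sup_norm_le_iff)
      show "0 \<le> c ^ Suc k * S * (\<Sum>i\<in>UNIV. J (mword a @ [i]))"
        using c S0 J0 by (intro mult_nonneg_nonneg sum_nonneg) auto
      show "\<forall>x. norm (mpartial a (grad (regularize \<phi> \<delta> f)) x)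
          \<le> c ^ Suc k * S * (\<Sum>i\<in>UNIV. J (mword a @ [i]))"
      proof
        fix x
        have "norm (mpartial a (grad (regularize \<phi> \<delta> f)) x)
            \<le> (\<Sum>i\<in>UNIV. \<bar>foldr partial (mword a @ [i]) (regularize \<phi> \<delta> f) x\<bar>)"
          unfolding mpartial_mword foldr_partial_grad[OF td] by (rule order_trans[OF norm_le_l1_cart]) simp
        also have "\<dots> \<le> (\<Sum>i\<in>UNIV. c ^ Suc k * (S * J (mword a @ [i])))"
        proof (intro sum_mono order_trans[OF bd] mult_right_mono power_increasing c)
          show "length (mword a @ [i]) \<le> Suc k" for i using a by (simp add: length_mword)
          show "0 \<le> S * J (mword a @ [i])" for i using S0 J0 by simp
        qed
        finally show "norm (mpartial a (grad (regularize \<phi> \<delta> f)) x)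
            \<le> c ^ Suc k * S * (\<Sum>i\<in>UNIV. J (mword a @ [i]))"
          by (simp add: sum_distrib_left mult.assoc)
      qed
    qed
    then have "Ck_norm k (grad (regularize \<phi> \<delta> f))
        \<le> (\<Sum>a | mdeg a \<le> k. ennreal (c ^ Suc k * S * (\<Sum>i\<in>UNIV. J (mword a @ [i]))))"
      unfolding Ck_norm_def by (intro sum_mono) auto
    also have "\<dots> = ennreal (\<Sum>a | mdeg a \<le> k. c ^ Suc k * S * (\<Sum>i\<in>UNIV. J (mword a @ [i])))"
      using c S0 J0 by (intro sum_ennreal mult_nonneg_nonneg sum_nonneg) auto
    also have "\<dots> = ennreal (A * S / \<delta> ^ Suc k)"
      by (simp add: A_def c_def sum_distrib_left sum_distrib_right sum_divide_distrib divide_simps mult_ac del: power_Suc)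
    finally have e: "Ck_norm k (grad (regularize \<phi> \<delta> f)) \<le> ennreal (A * S / \<delta> ^ Suc k)" .
    have "bounded (range (regularize \<phi> \<delta> f))"
      using bd[of "[]"] by (auto simp: bounded_iff)
    then have "regularize \<phi> \<delta> f \<in> Cb (Suc k)"
      using e by (intro in_Cb_grad td) (auto intro: le_less_trans)
    with e show "regularize \<phi> \<delta> f \<in> Cb (Suc k) \<and>
      Ck_norm k (grad (regularize \<phi> \<delta> f)) \<le> ennreal (A * S / \<delta> ^ Suc k)" by blast
  qed
qed

section \<open>Markov kernels, the time grid and the Euler scheme\<close>

lemma MbE:
  assumes "f \<in> Mb"
  obtains S where "0 \<le> S" "\<And>x. \<bar>f x\<bar> \<le> S" "sup_norm f = ennreal S"
proof -
  have "sup_norm f < \<top>" using assms by (simp add: Mb_def sup_norm_finite_iff)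
  then obtain S where S: "0 \<le> S" "sup_norm f = ennreal S" by (cases "sup_norm f") auto
  then have "\<forall>x. \<bar>f x\<bar> \<le> S" using sup_norm_le_iff[of S f] by auto
  with S that show thesis by blast
qed

lemma MbI: "f \<in> borel_measurable borel \<Longrightarrow> (\<And>x. \<bar>f x\<bar> \<le> S) \<Longrightarrow> f \<in> Mb"
  by (auto simp: Mb_def bounded_iff)

lemma diff_in_Mb:
  assumes "f \<in> Mb" "g \<in> Mb" shows "(\<lambda>x. f x - g x) \<in> Mb"
proof -
  obtain S T where "\<And>x. \<bar>f x\<bar> \<le> S" "\<And>x. \<bar>g x\<bar> \<le> T" using assms by (metis MbE)
  then have "\<bar>f x - g x\<bar> \<le> S + T" for x
    by (intro order_trans[OF abs_triangle_ineq4 add_mono])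
  then show ?thesis by (rule MbI[rotated]) (use assms in \<open>auto simp: Mb_def\<close>)
qed

lemma prob_kernelD:
  assumes "prob_kernel K"
  shows "prob_space (K x)" "sets (K x) = sets borel"
proof -
  have "K x \<in> space (prob_algebra borel)"
    using assms unfolding prob_kernel_def by (auto dest: measurable_space)
  then show "prob_space (K x)" "sets (K x) = sets borel" by (auto simp: space_prob_algebra)
qed

lemma integrable_Mb:
  assumes "finite_measure M" "sets M = sets borel" "f \<in> Mb"
  shows "integrable M f"
proof -
  interpret finite_measure M by fact
  obtain S where S: "\<And>x. \<bar>f x\<bar> \<le> S" using assms(3) by (metis MbE)
  have "f \<in> borel_measurable M"
    using assms(2,3) by (simp add: Mb_def cong: measurable_cong_sets)
  then show ?thesis by (rule integrable_const_bound[rotated, where B = S]) (simp add: S)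
qed

lemma kernel_op_bound:
  assumes "prob_kernel K" "f \<in> Mb" "\<And>x. \<bar>f x\<bar> \<le> S"
  shows "\<bar>kernel_op K f x\<bar> \<le> S"
proof -
  interpret prob_space "K x" by (rule prob_kernelD) fact
  have i: "integrable (K x) f"
    by (rule integrable_Mb) (use prob_kernelD[OF assms(1)] assms in \<open>auto intro: finite_measure_axioms\<close>)
  have "kernel_op K f x \<le> S"
    unfolding kernel_op_def using assms(3) by (intro integral_le_const i) (auto simp: abs_le_iff)
  moreover have "- S \<le> kernel_op K f x"
    unfolding kernel_op_def using assms(3)
    by (intro integral_ge_const i) (auto simp: abs_le_iff minus_le_iff)
  ultimately show ?thesis by linarith
qed

lemma kernel_op_in_Mb:
  assumes K: "prob_kernel K" and f: "f \<in> Mb"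
  shows "kernel_op K f \<in> Mb"
proof -
  obtain S where S: "\<And>x. \<bar>f x\<bar> \<le> S" using f by (metis MbE)
  have "K \<in> measurable borel (subprob_algebra borel)"
    using K unfolding prob_kernel_def by (rule measurable_prob_algebraD)
  moreover have "(\<lambda>M. integral\<^sup>L M f) \<in> borel_measurable (subprob_algebra borel)"
    using f by (intro integral_measurable_subprob_algebra) (simp add: Mb_def)
  ultimately have "kernel_op K f \<in> borel_measurable borel"
    unfolding kernel_op_def[abs_def] by (rule measurable_compose)
  then show ?thesis using kernel_op_bound[OF K f S] by (rule MbI)
qed

lemma kernel_op_diff:
  assumes "prob_kernel K" "f \<in> Mb" "g \<in> Mb"
  shows "kernel_op K (\<lambda>x. f x - g x) = (\<lambda>x. kernel_op K f x - kernel_op K g x)"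
proof
  fix x
  interpret prob_space "K x" by (rule prob_kernelD) fact
  have "integrable (K x) h" if "h \<in> Mb" for h
    by (rule integrable_Mb) (use prob_kernelD[OF assms(1)] that in \<open>auto intro: finite_measure_axioms\<close>)
  with assms show "kernel_op K (\<lambda>x. f x - g x) x = kernel_op K f x - kernel_op K g x"
    unfolding kernel_op_def by (intro Bochner_Integration.integral_diff)
qed

lemma kernel_op_contraction:
  assumes "prob_kernel K" "f \<in> Mb" "g \<in> Mb" "\<And>x. \<bar>f x - g x\<bar> \<le> S"
  shows "\<bar>kernel_op K f x - kernel_op K g x\<bar> \<le> S"
  using kernel_op_bound[OF assms(1) diff_in_Mb[OF assms(2,3)] assms(4), of x]
    kernel_op_diff[OF assms(1-3)] by (simp add: fun_eq_iff)

lemma grad_estimate_mono: "grad_estimate k f B \<Longrightarrow> B \<le> B' \<Longrightarrow> grad_estimate k f B'"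
  by (auto simp: grad_estimate_def)

lemma grad_estimate_in_Cb:
  assumes "f \<in> Mb" "grad_estimate k f (ennreal B)" shows "f \<in> Cb (Suc k)"
proof (rule in_Cb_grad)
  show "bounded (range f)" using assms(1) by (simp add: Mb_def)
  show "Ck_norm k (grad f) < \<top>"
    using assms(2) le_less_trans[OF _ ennreal_less_top] unfolding grad_estimate_def by blast
qed (use assms in \<open>simp add: grad_estimate_def\<close>)

text \<open>The constants in the hypotheses are reals of unknown sign seen through
  \<open>ennreal\<close>, which sends negative numbers to 0; \<open>max 0 c\<close> is the same
  constant as a nonnegative real.\<close>

lemma ennreal_mult_le:
  assumes "x \<le> ennreal y" "0 \<le> y"
  shows "ennreal c * x \<le> ennreal (max 0 c * y)"
proof -
  have "ennreal c = ennreal (max 0 c)" by (simp add: max_def ennreal_neg)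
  then have "ennreal c * x \<le> ennreal (max 0 c) * ennreal y"
    using assms(1) by (simp only:) (rule mult_left_mono, auto)
  then show ?thesis by (simp add: ennreal_mult assms(2))
qed

section \<open>The time grid\<close>

lemma Gam_Suc: "Gam \<gamma> (Suc n) = Gam \<gamma> n + \<gamma> (Suc n)"
  by (simp add: Gam_def)

lemma Gam_0: "Gam \<gamma> 0 = 0"
  by (simp add: Gam_def)

context
  fixes \<gamma> :: "nat \<Rightarrow> real"
  assumes steps: "step_sequence \<gamma>"
begin

lemma step_pos: "1 \<le> n \<Longrightarrow> 0 < \<gamma> n"
  and step_tendsto: "\<gamma> \<longlonglongrightarrow> 0"
  and Gam_tendsto: "filterlim (Gam \<gamma>) at_top sequentially"
  using steps by (auto simp: step_sequence_def)

lemma strict_mono_Gam: "strict_mono (Gam \<gamma>)"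
  by (rule strict_mono_Suc_iff[THEN iffD2]) (simp add: Gam_Suc step_pos)

lemma Gam_less_iff: "Gam \<gamma> i < Gam \<gamma> j \<longleftrightarrow> i < j"
  by (rule strict_mono_less[OF strict_mono_Gam])

lemma Gam_le_iff: "Gam \<gamma> i \<le> Gam \<gamma> j \<longleftrightarrow> i \<le> j"
  by (rule strict_mono_less_eq[OF strict_mono_Gam])

lemma Gam_nonneg: "0 \<le> Gam \<gamma> n"
  using Gam_le_iff[of 0 n] by (simp add: Gam_0)

lemma step_antimono:
  assumes "1 \<le> i" "i \<le> j" shows "\<gamma> j \<le> \<gamma> i"
  using assms(2,1)
proof (induction j rule: dec_induct)
  case (step n)
  then have "\<gamma> (Suc n) \<le> \<gamma> n" using steps by (simp add: step_sequence_def)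
  with step show ?case by simp
qed simp

lemma Nidx_bounds:
  assumes "0 \<le> t"
  shows "Gam \<gamma> (Nidx \<gamma> t) \<le> t" "t < Gam \<gamma> (Suc (Nidx \<gamma> t))"
proof -
  have ex: "\<exists>n. t < Gam \<gamma> n"
    using Gam_tendsto unfolding filterlim_at_top_dense eventually_sequentially by blast
  \<comment> \<open>\<open>N\<close> is the index of the first grid point beyond t. As
    \<open>Gam \<gamma> 0\<close> is 0 and t is nonnegative, it has a predecessor, which is the
    index sought.\<close>
  define N where "N = (LEAST n. t < Gam \<gamma> n)"
  have N: "t < Gam \<gamma> N" unfolding N_def by (rule LeastI_ex[OF ex])
  then obtain i where i: "N = Suc i" using assms by (cases N) (auto simp: Gam_0)
  then have *: "Gam \<gamma> i \<le> t" using not_less_Least[of i "\<lambda>n. t < Gam \<gamma> n"] by (simp add: N_def)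
  have "Gam \<gamma> (Nidx \<gamma> t) \<le> t \<and> t < Gam \<gamma> (Suc (Nidx \<gamma> t))"
    unfolding Nidx_def
  proof (rule theI)
    show "Gam \<gamma> i \<le> t \<and> t < Gam \<gamma> (Suc i)" using * N i by simp
    fix k assume k: "Gam \<gamma> k \<le> t \<and> t < Gam \<gamma> (Suc k)"
    then have "Gam \<gamma> k < Gam \<gamma> (Suc i)" "Gam \<gamma> i < Gam \<gamma> (Suc k)" using * N i by auto
    then show "k = i" unfolding Gam_less_iff by simp
  qed
  then show "Gam \<gamma> (Nidx \<gamma> t) \<le> t" "t < Gam \<gamma> (Suc (Nidx \<gamma> t))" by auto
qed

lemma Nidx_Gam: "Nidx \<gamma> (Gam \<gamma> n) = n"
  using Nidx_bounds[of "Gam \<gamma> n", OF Gam_nonneg] unfolding Gam_le_iff Gam_less_iff by simp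

end

text \<open>The scheme between grid indices, using steps a + 1 to b, so that no description operator
  as in \<open>Nidx\<close> occurs. The earliest step is the outermost operator; inductions
  therefore peel steps at the left end.\<close>

definition euler_op ::
  "(real \<Rightarrow> real ^ 'd::finite \<Rightarrow> (real ^ 'd) measure) \<Rightarrow> (nat \<Rightarrow> real) \<Rightarrow>
     nat \<Rightarrow> nat \<Rightarrow> (real ^ 'd \<Rightarrow> real) \<Rightarrow> real ^ 'd \<Rightarrow> real" where
  "euler_op Q \<gamma> a b f = foldr (\<lambda>i. kernel_op (Q (\<gamma> i))) [Suc a..<Suc b] f"

lemma euler_op_refl: "euler_op Q \<gamma> a a f = f"
  by (simp add: euler_op_def)

lemma euler_op_Suc:
  "a < b \<Longrightarrow> euler_op Q \<gamma> a b f = kernel_op (Q (\<gamma> (Suc a))) (euler_op Q \<gamma> (Suc a) b f)"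
  by (simp add: euler_op_def upt_conv_Cons del: upt_Suc)

lemma euler_op_comp:
  assumes "a \<le> b" "b \<le> c"
  shows "euler_op Q \<gamma> a c f = euler_op Q \<gamma> a b (euler_op Q \<gamma> b c f)"
proof -
  have "[Suc a..<Suc c] = [Suc a..<Suc b] @ [Suc b..<Suc c]"
    using upt_add_eq_append[of "Suc a" "Suc b" "c - b"] assms by (simp del: upt_Suc)
  then show ?thesis by (simp add: euler_op_def del: upt_Suc)
qed

locale euler_scheme =
  fixes P Q :: "real \<Rightarrow> real ^ 'd::finite \<Rightarrow> (real ^ 'd) measure" and \<gamma> :: "nat \<Rightarrow> real"
  assumes semigroup: "markov_semigroup P"
    and one_step: "one_step_operators Q"
    and steps: "step_sequence \<gamma>"
begin

lemma kernel_P: "0 \<le> t \<Longrightarrow> prob_kernel (P t)"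
  using semigroup by (simp add: markov_semigroup_def)

lemma P_0: "f \<in> Mb \<Longrightarrow> kernel_op (P 0) f = f"
  using semigroup by (simp add: markov_semigroup_def)

lemma P_add: "0 \<le> s \<Longrightarrow> 0 \<le> t \<Longrightarrow> f \<in> Mb \<Longrightarrow> kernel_op (P s) (kernel_op (P t) f) = kernel_op (P (s + t)) f"
  using semigroup by (simp add: markov_semigroup_def)

lemma kernel_Q: "1 \<le> i \<Longrightarrow> prob_kernel (Q (\<gamma> i))"
  using one_step step_pos[OF steps] by (simp add: one_step_operators_def)

lemma euler_eq_euler_op: "f \<in> Mb \<Longrightarrow> kernel_op (euler Q \<gamma> s t) f = euler_op Q \<gamma> (Nidx \<gamma> s) (Nidx \<gamma> t) f"
  unfolding euler_op_def using one_step step_pos[OF steps] by (intro kernel_op_euler) auto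

lemma prob_kernel_euler: "prob_kernel (euler Q \<gamma> s t)"
proof -
  have "prob_kernel (foldr (\<lambda>i K x. Q (\<gamma> i) x \<bind> K) is (return borel))" if "\<forall>i\<in>set is. 1 \<le> i" for "is"
    using that
  proof (induction "is")
    case Nil
    then show ?case by (simp add: prob_kernel_def measurable_return_prob_space)
  next
    case (Cons i "is")
    then show ?case by (auto intro!: prob_kernel_bind kernel_Q)
  qed
  then show ?thesis unfolding euler_def by (simp del: upt_Suc)
qed

lemma euler_op_in_Mb:
  assumes "a \<le> b" "f \<in> Mb" shows "euler_op Q \<gamma> a b f \<in> Mb"
  using assms(1)
  by (induction rule: inc_induct)
     (simp_all add: euler_op_refl euler_op_Suc assms(2) kernel_op_in_Mb kernel_Q)

lemma euler_op_contraction: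
  assumes "a \<le> b" "f \<in> Mb" "g \<in> Mb" "\<And>x. \<bar>f x - g x\<bar> \<le> S"
  shows "\<bar>euler_op Q \<gamma> a b f x - euler_op Q \<gamma> a b g x\<bar> \<le> S"
  using assms(1)
proof (induction arbitrary: x rule: inc_induct)
  case (step n)
  then show ?case
    unfolding euler_op_Suc[OF step.hyps(2)]
    by (intro kernel_op_contraction kernel_Q euler_op_in_Mb assms) auto
qed (simp add: euler_op_refl assms)

text \<open>Lindeberg's telescoping sum: the one-step errors add up because both families contract.\<close>

lemma euler_op_error:
  assumes "a \<le> b" "f \<in> Mb"
    and e: "\<And>i x. a < i \<Longrightarrow> i \<le> b \<Longrightarrow>
      \<bar>kernel_op (P (\<gamma> i)) (kernel_op (P (Gam \<gamma> b - Gam \<gamma> i)) f) x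
        - kernel_op (Q (\<gamma> i)) (kernel_op (P (Gam \<gamma> b - Gam \<gamma> i)) f) x\<bar> \<le> e i"
  shows "\<bar>euler_op Q \<gamma> a b f x - kernel_op (P (Gam \<gamma> b - Gam \<gamma> a)) f x\<bar> \<le> (\<Sum>i\<in>{a<..b}. e i)"
  using assms(1) e
proof (induction arbitrary: x rule: inc_induct)
  case base
  then show ?case by (simp add: euler_op_refl P_0 assms(2))
next
  case (step n)
  let ?g = "kernel_op (P (Gam \<gamma> b - Gam \<gamma> (Suc n))) f"
  let ?E = "euler_op Q \<gamma> (Suc n) b f"
  have n: "n < b" by fact
  have d: "0 \<le> Gam \<gamma> b - Gam \<gamma> (Suc n)" using n Gam_le_iff[OF steps, of "Suc n" b] by simp
  have g: "?g \<in> Mb" by (intro kernel_op_in_Mb kernel_P d assms)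
  have "\<bar>kernel_op (Q (\<gamma> (Suc n))) ?E x - kernel_op (Q (\<gamma> (Suc n))) ?g x\<bar> \<le> (\<Sum>i\<in>{Suc n<..b}. e i)"
    by (intro kernel_op_contraction kernel_Q euler_op_in_Mb g assms step.IH step.prems) (use n in auto)
  moreover have "\<bar>kernel_op (P (\<gamma> (Suc n))) ?g x - kernel_op (Q (\<gamma> (Suc n))) ?g x\<bar> \<le> e (Suc n)"
    by (rule step.prems) (use n in auto)
  moreover have "kernel_op (P (\<gamma> (Suc n))) ?g x = kernel_op (P (Gam \<gamma> b - Gam \<gamma> n)) f x"
    using d step_pos[OF steps, of "Suc n"] by (subst P_add) (auto simp: assms Gam_Suc)
  moreover have "{n<..b} = insert (Suc n) {Suc n<..b}" using n by auto
  then have "(\<Sum>i\<in>{n<..b}. e i) = e (Suc n) + (\<Sum>i\<in>{Suc n<..b}. e i)" by simp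
  ultimately show ?case unfolding euler_op_Suc[OF n] by linarith
qed

end

section \<open>Smoothing and invariant measures\<close>

context euler_scheme
begin

text \<open>For large s, \<open>P s\<close> splits into unit time, time s - 2 and unit time: the
  factor applied to f makes it differentiable by \<open>h2\<close>, the middle one brings
  exponential decay of the gradient by \<open>h4\<close>, and the outer one converts a gradient
  bound into bounds on k + 1 derivatives by \<open>h3\<close>.\<close>

lemma smoothing_decay:
  assumes h2: "\<forall>k\<ge>1. \<exists>C::real. \<forall>f\<in>Mb. \<forall>t\<in>{1..2}.
        grad_estimate (k - 1) (kernel_op (P t) f) (ennreal C * sup_norm f)"
    and h3: "\<forall>k\<ge>1. \<exists>C::real. \<forall>f\<in>Cb 1. \<forall>t\<in>{1..2}.
        grad_estimate (k - 1) (kernel_op (P t) f) (ennreal C * sup_norm (grad f))"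
    and h4: "\<exists>C::real. \<forall>f\<in>Cb 1. \<forall>t\<ge>1. grad_estimate 0 (kernel_op (P t) f)
            (ennreal C * Ck_norm 0 (grad f) * ennreal (exp (- \<rho> * t)))"
    and \<rho>: "0 < \<rho>"
  obtains C where "0 \<le> C"
    "\<And>s f S. 1 \<le> s \<Longrightarrow> f \<in> Mb \<Longrightarrow> (\<And>x. \<bar>f x\<bar> \<le> S) \<Longrightarrow>
      grad_estimate k (kernel_op (P s) f) (ennreal (C * S * exp (- \<rho> * s)))"
proof -
  obtain C1 where "\<forall>f\<in>Mb. \<forall>t\<in>{1..2}. grad_estimate (Suc k - 1) (kernel_op (P t) f) (ennreal C1 * sup_norm f)"
    using h2[rule_format, of "Suc k"] by auto
  then have C1: "grad_estimate k (kernel_op (P 1) f) (ennreal C1 * sup_norm f)" if "f \<in> Mb" for f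
    using that by simp
  obtain C2 where "\<forall>f\<in>Mb. \<forall>t\<in>{1..2}. grad_estimate (1 - 1) (kernel_op (P t) f) (ennreal C2 * sup_norm f)"
    using h2[rule_format, of 1] by auto
  then have C2: "grad_estimate 0 (kernel_op (P 1) f) (ennreal C2 * sup_norm f)" if "f \<in> Mb" for f
    using that by simp
  obtain C3 where "\<forall>f\<in>Cb 1. \<forall>t\<in>{1..2}. grad_estimate (Suc k - 1) (kernel_op (P t) f) (ennreal C3 * sup_norm (grad f))"
    using h3[rule_format, of "Suc k"] by auto
  then have C3: "grad_estimate k (kernel_op (P 1) f) (ennreal C3 * sup_norm (grad f))" if "f \<in> Cb 1" for f
    using that by simp
  obtain C4 where C4: "\<forall>f\<in>Cb 1. \<forall>t\<ge>1. grad_estimate 0 (kernel_op (P t) f)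
            (ennreal C4 * Ck_norm 0 (grad f) * ennreal (exp (- \<rho> * t)))"
    using h4 by blast
  define c1 c2 c3 c4 where "c1 = max 0 C1" and "c2 = max 0 C2" and "c3 = max 0 C3" and "c4 = max 0 C4"
  note c_def = c1_def c2_def c3_def c4_def
  have c: "0 \<le> c1" "0 \<le> c2" "0 \<le> c3" "0 \<le> c4" by (simp_all add: c_def)
  \<comment> \<open>One summand per case: exp(2\<rho>) makes up for the two units of time spent on
    smoothing, and exp(3\<rho>) offsets the factor exp(-\<rho> s) when s \<le> 3.\<close>
  let ?C = "c1 * exp (3 * \<rho>) + c3 * (c4 * c2) * exp (2 * \<rho>)"
  show thesis
  proof (rule that)
    show "0 \<le> ?C" using c by simp
    fix s S :: real and f :: "real ^ 'd \<Rightarrow> real"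
    assume s: "1 \<le> s" and f: "f \<in> Mb" and S: "\<And>x. \<bar>f x\<bar> \<le> S"
    have S0: "0 \<le> S" using S[of undefined] by linarith
    have sup: "sup_norm g \<le> ennreal S" if "\<And>x. \<bar>g x\<bar> \<le> S" for g :: "real ^ 'd \<Rightarrow> real"
      using that S0 by (simp add: sup_norm_le_iff)
    show "grad_estimate k (kernel_op (P s) f) (ennreal (?C * S * exp (- \<rho> * s)))"
    \<comment> \<open>The decay estimate needs s - 2 \<ge> 1. For shorter times it is enough to
      smooth once after \<open>P (s - 1)\<close>, which preserves the bound S.\<close>
    proof (cases "s \<le> 3")
      case True
      let ?g = "kernel_op (P (s - 1)) f"
      have g: "?g \<in> Mb" using s by (intro kernel_op_in_Mb kernel_P f) auto
      have "sup_norm ?g \<le> ennreal S"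
        using s by (intro sup kernel_op_bound kernel_P f S) auto
      from ennreal_mult_le[OF this S0, of C1]
      have "grad_estimate k (kernel_op (P 1) ?g) (ennreal (c1 * S))"
        unfolding c_def by (rule grad_estimate_mono[OF C1[OF g]])
      moreover have "c1 * S \<le> ?C * S * exp (- \<rho> * s)"
      proof -
        have "c1 * S * 1 \<le> c1 * S * (exp (3 * \<rho>) * exp (- \<rho> * s))"
          using c S0 True \<rho> by (intro mult_left_mono) (auto simp: mult.commute simp flip: exp_add)
        also have "\<dots> = c1 * exp (3 * \<rho>) * S * exp (- \<rho> * s)" by simp
        also have "\<dots> \<le> ?C * S * exp (- \<rho> * s)"
          using c S0 by (intro mult_right_mono) auto
        finally show ?thesis by simp
      qed
      moreover have "kernel_op (P 1) ?g = kernel_op (P s) f"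
        using s by (subst P_add) (auto simp: f)
      ultimately show ?thesis by (auto intro: grad_estimate_mono ennreal_leI)
    next
      case False
      let ?h = "kernel_op (P 1) f"
      have h: "?h \<in> Mb" by (intro kernel_op_in_Mb kernel_P f) auto
      have "grad_estimate 0 ?h (ennreal (c2 * S))"
        unfolding c_def by (rule grad_estimate_mono[OF C2[OF f] ennreal_mult_le[OF sup[OF S] S0]])
      then have h1: "?h \<in> Cb 1" "Ck_norm 0 (grad ?h) \<le> ennreal (c2 * S)"
        using grad_estimate_in_Cb[OF h] by (auto simp: grad_estimate_def)
      let ?g = "kernel_op (P (s - 2)) ?h"
      have g: "?g \<in> Mb" using False by (intro kernel_op_in_Mb kernel_P h) auto
      have "ennreal C4 * Ck_norm 0 (grad ?h) * ennreal (exp (- \<rho> * (s - 2)))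
          \<le> ennreal (c4 * (c2 * S)) * ennreal (exp (- \<rho> * (s - 2)))"
        using ennreal_mult_le[OF h1(2), of C4] c S0 unfolding c4_def by (intro mult_right_mono) auto
      also have "\<dots> = ennreal (c4 * c2 * S * exp (2 * \<rho>) * exp (- \<rho> * s))"
        using c S0 by (simp add: algebra_simps flip: ennreal_mult exp_add)
      finally have "grad_estimate 0 ?g (ennreal (c4 * c2 * S * exp (2 * \<rho>) * exp (- \<rho> * s)))"
        by (rule grad_estimate_mono[OF C4[rule_format, OF h1(1)], rotated]) (use False in simp)
      then have g1: "?g \<in> Cb 1" "sup_norm (grad ?g) \<le> ennreal (c4 * c2 * S * exp (2 * \<rho>) * exp (- \<rho> * s))"
        using grad_estimate_in_Cb[OF g] by (auto simp: grad_estimate_def Ck_norm_0)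
      have "grad_estimate k (kernel_op (P 1) ?g)
          (ennreal (c3 * (c4 * c2 * S * exp (2 * \<rho>) * exp (- \<rho> * s))))"
        unfolding c3_def using c S0
        by (intro grad_estimate_mono[OF C3[OF g1(1)] ennreal_mult_le[OF g1(2)]]) auto
      moreover have "c3 * (c4 * c2 * S * exp (2 * \<rho>) * exp (- \<rho> * s)) \<le> ?C * S * exp (- \<rho> * s)"
      proof -
        have "c3 * (c4 * c2 * S * exp (2 * \<rho>) * exp (- \<rho> * s))
            = c3 * (c4 * c2) * exp (2 * \<rho>) * S * exp (- \<rho> * s)" by simp
        also have "\<dots> \<le> ?C * S * exp (- \<rho> * s)"
          using c S0 by (intro mult_right_mono) auto
        finally show ?thesis .
      qed
      moreover have "kernel_op (P 1) ?g = kernel_op (P s) f"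
        using False by (subst P_add | simp add: f h)+
      ultimately show ?thesis by (auto intro: grad_estimate_mono ennreal_leI)
    qed
  qed
qed

text \<open>Under an invariant measure the integral of f equals that of \<open>P n f\<close>, which
  flattens out as n grows; it is therefore the limit of \<open>P n f\<close> at 0, a number that
  does not involve the measure. The base point 0 is arbitrary.\<close>

lemma invariant_prob_unique:
  assumes \<rho>: "0 < \<rho>"
    and L: "\<And>t f S x y. 1 \<le> t \<Longrightarrow> f \<in> Mb \<Longrightarrow> (\<And>x. \<bar>f x\<bar> \<le> S) \<Longrightarrow>
      \<bar>kernel_op (P t) f x - kernel_op (P t) f y\<bar> \<le> C * S * exp (- \<rho> * t) * dist x y"
    and \<nu>: "invariant_prob P \<nu>" and \<nu>': "invariant_prob P \<nu>'"
  shows "\<nu>' = \<nu>"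
proof -
  have lim: "(\<lambda>n. kernel_op (P (real n)) f 0) \<longlonglongrightarrow> (\<integral>x. f x \<partial>\<mu>)"
    if \<mu>: "invariant_prob P \<mu>" and f: "f \<in> Mb" for \<mu> f
  proof -
    interpret prob_space \<mu> using \<mu> by (simp add: invariant_prob_def)
    have s: "sets \<mu> = sets borel" using \<mu> by (simp add: invariant_prob_def)
    obtain S where S: "0 \<le> S" "\<And>x. \<bar>f x\<bar> \<le> S" using f by (metis MbE)
    have Pf: "kernel_op (P (real n)) f \<in> Mb" for n
      by (intro kernel_op_in_Mb kernel_P f) auto
    have PS: "\<bar>kernel_op (P (real n)) f x\<bar> \<le> S" for n x
      by (intro kernel_op_bound kernel_P f S) auto
    have i: "integrable \<mu> g" if "g \<in> Mb" for g
      by (rule integrable_Mb[OF _ s that]) (rule finite_measure_axioms)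
    let ?d = "\<lambda>n x. kernel_op (P (real n)) f x - kernel_op (P (real n)) f 0"
    have d: "?d n \<in> Mb" for n
      by (intro diff_in_Mb Pf) (auto intro: MbI)
    \<comment> \<open>Dominated convergence with the constant 2S avoids integrating the distance,
      since an invariant measure may have infinite first moment.\<close>
    have "(\<lambda>n. \<integral>x. ?d n x \<partial>\<mu>) \<longlonglongrightarrow> (\<integral>x. 0 \<partial>\<mu>)"
    proof (rule integral_dominated_convergence[where w = "\<lambda>_. 2 * S"])
      show "?d n \<in> borel_measurable \<mu>" for n
        using i[OF d] by (rule borel_measurable_integrable)
      show "AE x in \<mu>. norm (?d n x) \<le> 2 * S" for n
      proof (rule AE_I2)
        fix x :: "real ^ 'd"
        show "norm (?d n x) \<le> 2 * S" using PS[of n x] PS[of n 0] by (simp add: abs_le_iff)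
      qed
      show "AE x in \<mu>. (\<lambda>n. ?d n x) \<longlonglongrightarrow> 0"
      proof (rule AE_I2)
        fix x :: "real ^ 'd"
        have "(\<lambda>n. exp (- \<rho> * real n)) \<longlonglongrightarrow> 0"
          using \<rho> by real_asymp
        from tendsto_mult_right_zero[OF this, of "C * S * dist x 0"]
        have "(\<lambda>n. C * S * exp (- \<rho> * real n) * dist x 0) \<longlonglongrightarrow> 0"
          by (simp add: mult_ac)
        then show "(\<lambda>n. ?d n x) \<longlonglongrightarrow> 0"
        proof (rule Lim_null_comparison[rotated])
          show "\<forall>\<^sub>F n in sequentially. norm (?d n x) \<le> C * S * exp (- \<rho> * real n) * dist x 0"
            using eventually_ge_at_top[of 1]
            by eventually_elim (unfold real_norm_def, rule L, auto intro: f S)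
        qed
      qed
    qed auto
    moreover have "(\<integral>x. ?d n x \<partial>\<mu>) = (\<integral>x. f x \<partial>\<mu>) - kernel_op (P (real n)) f 0" for n
    proof -
      have "(\<integral>x. kernel_op (P (real n)) f x \<partial>\<mu>) = (\<integral>x. f x \<partial>\<mu>)"
        using \<mu> f by (simp add: invariant_prob_def)
      then show ?thesis using i[OF Pf] by (simp add: prob_space)
    qed
    ultimately have "(\<lambda>n. (\<integral>x. f x \<partial>\<mu>) - kernel_op (P (real n)) f 0) \<longlonglongrightarrow> 0" by simp
    from tendsto_diff[OF tendsto_const[of "\<integral>x. f x \<partial>\<mu>"] this] show ?thesis by simp
  qed
  show ?thesis
  proof (rule measure_eqI)
    show "sets \<nu>' = sets \<nu>" using \<nu> \<nu>' by (simp add: invariant_prob_def)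
    fix A assume "A \<in> sets \<nu>'"
    then have A: "A \<in> sets borel" using \<nu>' by (simp add: invariant_prob_def)
    have "(indicator A :: _ \<Rightarrow> real) \<in> Mb"
      using A by (intro MbI[where S = 1]) (auto simp: indicator_def)
    from LIMSEQ_unique[OF lim[OF \<nu>' this] lim[OF \<nu> this]]
    have "measure \<nu>' A = measure \<nu> A"
      using \<nu> \<nu>' A by (simp add: invariant_prob_def)
    moreover have "finite_measure \<nu>" "finite_measure \<nu>'"
      using \<nu> \<nu>' by (auto simp: invariant_prob_def prob_space.finite_measure)
    ultimately show "emeasure \<nu>' A = emeasure \<nu> A"
      by (simp add: finite_measure.emeasure_eq_measure)
  qed
qed

text \<open>By invariance the deviation is the \<nu>-average of the differences of
  \<open>P t f\<close> between x and y. The first moment is an \<open>ennreal\<close> integral and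
  may be infinite.\<close>

lemma invariant_prob_deviation:
  assumes \<nu>: "invariant_prob P \<nu>" and t: "0 \<le> t" and f: "f \<in> Mb" and K: "0 \<le> K"
    and L: "\<And>y. \<bar>kernel_op (P t) f x - kernel_op (P t) f y\<bar> \<le> K * dist x y"
  shows "ennreal \<bar>kernel_op (P t) f x - (\<integral>y. f y \<partial>\<nu>)\<bar> \<le> ennreal K * (\<integral>\<^sup>+y. ennreal (dist x y) \<partial>\<nu>)"
proof -
  interpret prob_space \<nu> using \<nu> by (simp add: invariant_prob_def)
  have s: "sets \<nu> = sets borel" using \<nu> by (simp add: invariant_prob_def)
  have i: "integrable \<nu> (kernel_op (P t) f)"
    by (rule integrable_Mb[OF finite_measure_axioms s]) (intro kernel_op_in_Mb kernel_P f t)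
  have "(\<integral>y. kernel_op (P t) f y \<partial>\<nu>) = (\<integral>y. f y \<partial>\<nu>)"
    using \<nu> f t by (simp add: invariant_prob_def)
  then have "kernel_op (P t) f x - (\<integral>y. f y \<partial>\<nu>) = (\<integral>y. kernel_op (P t) f x - kernel_op (P t) f y \<partial>\<nu>)"
    using i by (simp add: prob_space)
  then have "ennreal \<bar>kernel_op (P t) f x - (\<integral>y. f y \<partial>\<nu>)\<bar>
      \<le> (\<integral>\<^sup>+y. ennreal (norm (kernel_op (P t) f x - kernel_op (P t) f y)) \<partial>\<nu>)"
    using integral_norm_bound_ennreal[of \<nu> "\<lambda>y. kernel_op (P t) f x - kernel_op (P t) f y"] i by simp
  also have "\<dots> \<le> (\<integral>\<^sup>+y. ennreal K * ennreal (dist x y) \<partial>\<nu>)"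
    using L K by (intro nn_integral_mono) (simp add: ennreal_leI flip: ennreal_mult)
  also have "\<dots> = ennreal K * (\<integral>\<^sup>+y. ennreal (dist x y) \<partial>\<nu>)"
  proof (rule nn_integral_cmult)
    have "(\<lambda>y. ennreal (dist x y)) \<in> borel_measurable borel" by measurable
    then show "(\<lambda>y. ennreal (dist x y)) \<in> borel_measurable \<nu>"
      using s by (simp cong: measurable_cong_sets)
  qed
  finally show ?thesis .
qed

end

text \<open>Here \<delta> = g^e1 and \<eta> = g^e2. The condition on \<open>e1\<close> makes k + 1
  derivatives of the mollified function cost exactly g^(-\<epsilon>); L is the ratio allowed between
  an earlier step size and g.\<close>

lemma parameter_choice:
  fixes p \<beta> \<theta> a :: real
  assumes "p > 0" "\<beta> > 0" "\<epsilon> > 0"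
  obtains q \<kappa> :: nat and e1 e2 :: real where "e1 * (real k + 1) = \<epsilon>" "e1 > 0"
    "\<And>g L. 0 < g \<Longrightarrow> g < 1 \<Longrightarrow> 0 \<le> L \<Longrightarrow>
      (g powr e1) ^ q / (g powr e2) ^ (2 * q) + (g powr e2) powr (- p) * (L * g) powr (\<beta> * p) + (g powr e2) ^ \<kappa>
      \<le> (2 + L powr (\<beta> * p)) * g powr (min (p * \<beta>) \<alpha> - \<epsilon>)"
proof -
  define e1 where "e1 = \<epsilon> / (real k + 1)"
  have e1: "e1 > 0" "e1 * (real k + 1) = \<epsilon>" using assms by (auto simp: e1_def)
  \<comment> \<open>The bound e1 / 4 leaves e1 - 2 e2 \<ge> e2, so the first error term keeps a
    positive exponent; the bound \<epsilon> / p limits the loss \<eta>^(-p) to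
    g^(-\<epsilon>).\<close>
  define e2 where "e2 = min (e1 / 4) (\<epsilon> / p)"
  have e2: "e2 > 0" "4 * e2 \<le> e1" "p * e2 \<le> \<epsilon>"
    using assms e1 by (auto simp: e2_def min_def field_simps)
  obtain \<kappa> :: nat where \<kappa>: "\<alpha> < real \<kappa> * e2" using e2(1) reals_Archimedean3 by blast
  show thesis
  \<comment> \<open>One integer serves as \<open>q\<close> and as \<open>\<kappa>\<close>: both
    exponents \<open>\<kappa> * (e1 - 2 * e2)\<close> and \<open>\<kappa> * e2\<close> exceed
    \<alpha>.\<close>
  proof (rule that[of e1 \<kappa> e2 \<kappa>])
    fix g L :: real assume g: "0 < g" "g < 1" and L: "0 \<le> L"
    let ?\<theta> = "min (p * \<beta>) \<alpha> - \<epsilon>"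
    have le: "g powr b \<le> g powr ?\<theta>" if "?\<theta> \<le> b" for b
      using g that by (intro powr_mono') auto
    have "(g powr e1) ^ \<kappa> / (g powr e2) ^ (2 * \<kappa>) = g powr (real \<kappa> * (e1 - 2 * e2))"
      using g by (simp add: powr_powr powr_diff algebra_simps flip: powr_realpow)
    also have "\<dots> \<le> g powr ?\<theta>"
    proof (rule le)
      have "real \<kappa> * e2 \<le> real \<kappa> * (e1 - 2 * e2)" using e2 by (intro mult_left_mono) auto
      then show "?\<theta> \<le> real \<kappa> * (e1 - 2 * e2)" using \<kappa> assms by linarith
    qed
    finally have 1: "(g powr e1) ^ \<kappa> / (g powr e2) ^ (2 * \<kappa>) \<le> g powr ?\<theta>" .
    have "(g powr e2) ^ \<kappa> = g powr (real \<kappa> * e2)"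
      using g by (simp add: powr_powr mult.commute flip: powr_realpow)
    also have "\<dots> \<le> g powr ?\<theta>" using \<kappa> assms by (intro le) linarith
    finally have 2: "(g powr e2) ^ \<kappa> \<le> g powr ?\<theta>" .
    have "(g powr e2) powr (- p) * (L * g) powr (\<beta> * p) = L powr (\<beta> * p) * g powr (\<beta> * p - p * e2)"
      using g L by (simp add: powr_powr powr_mult powr_diff powr_minus_divide mult.commute)
    also have "\<dots> \<le> L powr (\<beta> * p) * g powr ?\<theta>"
      using e2 by (intro mult_left_mono le) (auto simp: mult.commute)
    finally show "(g powr e1) ^ \<kappa> / (g powr e2) ^ (2 * \<kappa>)
        + (g powr e2) powr (- p) * (L * g) powr (\<beta> * p) + (g powr e2) ^ \<kappa>
      \<le> (2 + L powr (\<beta> * p)) * g powr ?\<theta>"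
      using 1 2 by (simp add: algebra_simps)
  qed (use e1 in auto)
qed

section \<open>The error of the Euler scheme\<close>

context euler_scheme
begin

text \<open>The split point is \<open>\<Gamma>\<^sub>m\<close>, \<open>m = N(\<Gamma>\<^sub>n - 1)\<close>. Before it, at least one unit of time remains and
  \<open>P\<close> smooths \<open>f\<close> itself; after it, \<open>f\<close> is replaced by \<open>f\<^sub>\<delta>\<close>.\<close>

lemma euler_error_eventually:
  assumes "super_kernel \<phi>"
    and beta: "\<beta> > 0" and p: "p \<ge> 1" and alpha: "\<alpha> > 0" and eps: "\<epsilon> > 0"
    and h1: "\<exists>C::real. \<forall>h>0. \<forall>f\<in>Cb (k\<^sub>0 + 1).
        sup_norm (\<lambda>x. kernel_op (P h) f x - kernel_op (Q h) f x)
          \<le> ennreal C * Ck_norm k\<^sub>0 (grad f) * ennreal (h powr (1 + \<alpha>))"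
    and D: "0 \<le> D" "\<And>s f S. 1 \<le> s \<Longrightarrow> f \<in> Mb \<Longrightarrow> (\<And>x. \<bar>f x\<bar> \<le> S) \<Longrightarrow>
      grad_estimate k\<^sub>0 (kernel_op (P s) f) (ennreal (D * S * exp (- \<rho> * s)))"
    and h4: "\<exists>C::real. \<forall>f\<in>Cb (k\<^sub>0 + 1). \<forall>t. 0 < t \<and> t \<le> 1 \<longrightarrow>
          grad_estimate k\<^sub>0 (kernel_op (P t) f) (ennreal C * Ck_norm k\<^sub>0 (grad f))"
    and h5: "\<forall>q \<kappa> :: nat. \<exists>C::real. \<forall>\<delta>>0. \<forall>\<eta>>0. \<forall>t\<in>range (Gam \<gamma>). \<forall>r\<in>range (Gam \<gamma>). \<forall>f\<in>Mb.
        1 < t \<and> t < r \<and> r < t + 2 \<and> Nidx \<gamma> (t - 1) \<ge> 1 \<longrightarrow>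
        sup_norm (\<lambda>x. kernel_op (euler Q \<gamma> (t - 1) t) (kernel_op (P (r - t)) f) x
            - kernel_op (euler Q \<gamma> (t - 1) t) (kernel_op (P (r - t)) (regularize \<phi> \<delta> f)) x)
        + sup_norm (\<lambda>x. kernel_op (euler Q \<gamma> (t - 1) t) (kernel_op (euler Q \<gamma> t r) f) x
            - kernel_op (euler Q \<gamma> (t - 1) t) (kernel_op (euler Q \<gamma> t r) (regularize \<phi> \<delta> f)) x)
        \<le> ennreal C * ennreal (\<delta> ^ q / \<eta> ^ (2 * q)
              + \<eta> powr (- p) * \<gamma> (Nidx \<gamma> (t - 1)) powr (\<beta> * p) + \<eta> ^ \<kappa>) * sup_norm f"
    and n_rho_prop: "\<exists>C::real. \<forall>n\<ge>n_rho. n \<ge> 1 \<longrightarrow>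
        (\<Sum>i=1..n. \<gamma> i powr (1 + \<alpha>) * exp (- \<rho> * (Gam \<gamma> n - Gam \<gamma> i))) \<le> C * \<gamma> n powr \<alpha>"
    and n_star_prop: "\<forall>i n. 1 \<le> i \<and> n_star \<le> i \<and> i \<le> n \<longrightarrow>
        \<gamma> i \<le> exp (2 * \<omega> * (Gam \<gamma> n - Gam \<gamma> i)) * \<gamma> n"
  obtains C n0 where "0 \<le> C"
    "\<And>f S n x. n0 \<le> n \<Longrightarrow> f \<in> Mb \<Longrightarrow> sup_norm f = ennreal S \<Longrightarrow> 0 \<le> S \<Longrightarrow>
      \<bar>euler_op Q \<gamma> 0 n f x - kernel_op (P (Gam \<gamma> n)) f x\<bar> \<le> C * S * \<gamma> n powr (min (p * \<beta>) \<alpha> - \<epsilon>)"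
proof -
  note Gl = Gam_less_iff[OF steps] Gam_le_iff[OF steps]
  obtain C1 where C1: "\<And>h f. 0 < h \<Longrightarrow> f \<in> Cb (Suc k\<^sub>0) \<Longrightarrow>
      sup_norm (\<lambda>x. kernel_op (P h) f x - kernel_op (Q h) f x)
        \<le> ennreal C1 * Ck_norm k\<^sub>0 (grad f) * ennreal (h powr (1 + \<alpha>))"
    using h1 by auto
  define c1 where "c1 = max 0 C1"
  have c1: "0 \<le> c1" by (simp add: c1_def)
  have one_step_error: "\<bar>kernel_op (P h) f x - kernel_op (Q h) f x\<bar> \<le> c1 * G * h powr (1 + \<alpha>)"
    if h: "0 < h" and f: "f \<in> Mb" and g: "grad_estimate k\<^sub>0 f (ennreal G)" and G: "0 \<le> G" for h f G x
  proof -
    have "f \<in> Cb (Suc k\<^sub>0)" by (rule grad_estimate_in_Cb[OF f g])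
    note C1[OF h this]
    also have "ennreal C1 * Ck_norm k\<^sub>0 (grad f) * ennreal (h powr (1 + \<alpha>))
        \<le> ennreal (c1 * G) * ennreal (h powr (1 + \<alpha>))"
      using ennreal_mult_le[of "Ck_norm k\<^sub>0 (grad f)" G C1] g G unfolding c1_def grad_estimate_def
      by (intro mult_right_mono) auto
    also have "\<dots> = ennreal (c1 * G * h powr (1 + \<alpha>))"
      using c1 G by (simp flip: ennreal_mult)
    finally show ?thesis using c1 G by (simp add: sup_norm_le_iff)
  qed
  obtain C2 where C2: "\<And>t f. 0 < t \<Longrightarrow> t \<le> 1 \<Longrightarrow> f \<in> Cb (Suc k\<^sub>0) \<Longrightarrow>
      grad_estimate k\<^sub>0 (kernel_op (P t) f) (ennreal C2 * Ck_norm k\<^sub>0 (grad f))"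
    using h4 by auto
  \<comment> \<open>Time 0 occurs after the last step, where \<open>P 0\<close> is the identity; a
    constant of at least 1 covers it along with the assumed range 0 < t \<le> 1.\<close>
  define c2 where "c2 = max 1 C2"
  have c2: "1 \<le> c2" by (simp add: c2_def)
  have short_time: "grad_estimate k\<^sub>0 (kernel_op (P t) f) (ennreal (c2 * G))"
    if t: "0 \<le> t" "t \<le> 1" and f: "f \<in> Cb (Suc k\<^sub>0)" and g: "Ck_norm k\<^sub>0 (grad f) \<le> ennreal G" and G: "0 \<le> G"
    for t f G
  proof (cases "t = 0")
    case True
    have "G \<le> c2 * G" using c2 G mult_right_mono[of 1 c2 G] by simp
    then have "Ck_norm k\<^sub>0 (grad f) \<le> ennreal (c2 * G)" using g by (meson ennreal_leI order_trans)
    then show ?thesis using f True by (simp add: P_0[OF Cb_Suc_in_Mb[OF f]] grad_estimate_def Cb_def)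
  next
    case False
    have "max 0 C2 * G \<le> c2 * G" using G by (intro mult_right_mono) (auto simp: c2_def)
    then have "ennreal C2 * Ck_norm k\<^sub>0 (grad f) \<le> ennreal (c2 * G)"
      using ennreal_mult_le[OF g G, of C2] by (meson ennreal_leI order_trans)
    then show ?thesis using C2[of t f] t f False by (auto intro: grad_estimate_mono)
  qed
  obtain A where A: "0 \<le> A"
    "\<And>f S \<delta>. f \<in> borel_measurable borel \<Longrightarrow> (\<And>y. \<bar>f y\<bar> \<le> S) \<Longrightarrow> 0 < \<delta> \<Longrightarrow> \<delta> \<le> 1 \<Longrightarrow>
      regularize \<phi> \<delta> f \<in> Cb (Suc k\<^sub>0) \<and>
      Ck_norm k\<^sub>0 (grad (regularize \<phi> \<delta> f)) \<le> ennreal (A * S / \<delta> ^ Suc k\<^sub>0)"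
    using regularize_grad_estimate[of \<phi> k\<^sub>0] assms(1) unfolding super_kernel_def by blast
  obtain q \<kappa> :: nat and e1 e2 :: real where e1: "e1 * (real k\<^sub>0 + 1) = \<epsilon>" "e1 > 0" and
    par: "\<And>g L. 0 < g \<Longrightarrow> g < 1 \<Longrightarrow> 0 \<le> L \<Longrightarrow>
      (g powr e1) ^ q / (g powr e2) ^ (2 * q) + (g powr e2) powr (- p) * (L * g) powr (\<beta> * p) + (g powr e2) ^ \<kappa>
      \<le> (2 + L powr (\<beta> * p)) * g powr (min (p * \<beta>) \<alpha> - \<epsilon>)"
    by (rule parameter_choice[OF less_le_trans[OF zero_less_one p] beta eps, of k\<^sub>0 \<alpha>]) (rule that)
  obtain C5 where C5: "\<forall>\<delta>>0. \<forall>\<eta>>0. \<forall>t\<in>range (Gam \<gamma>). \<forall>r\<in>range (Gam \<gamma>). \<forall>f\<in>Mb.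
        1 < t \<and> t < r \<and> r < t + 2 \<and> Nidx \<gamma> (t - 1) \<ge> 1 \<longrightarrow>
        sup_norm (\<lambda>x. kernel_op (euler Q \<gamma> (t - 1) t) (kernel_op (P (r - t)) f) x
            - kernel_op (euler Q \<gamma> (t - 1) t) (kernel_op (P (r - t)) (regularize \<phi> \<delta> f)) x)
        + sup_norm (\<lambda>x. kernel_op (euler Q \<gamma> (t - 1) t) (kernel_op (euler Q \<gamma> t r) f) x
            - kernel_op (euler Q \<gamma> (t - 1) t) (kernel_op (euler Q \<gamma> t r) (regularize \<phi> \<delta> f)) x)
        \<le> ennreal C5 * ennreal (\<delta> ^ q / \<eta> ^ (2 * q)
              + \<eta> powr (- p) * \<gamma> (Nidx \<gamma> (t - 1)) powr (\<beta> * p) + \<eta> ^ \<kappa>) * sup_norm f"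
    using h5 by meson
  define c5 where "c5 = max 0 C5"
  have c5: "0 \<le> c5" by (simp add: c5_def)
  obtain C6 where C6: "\<And>n. n_rho \<le> n \<Longrightarrow> 1 \<le> n \<Longrightarrow>
        (\<Sum>i=1..n. \<gamma> i powr (1 + \<alpha>) * exp (- \<rho> * (Gam \<gamma> n - Gam \<gamma> i))) \<le> C6 * \<gamma> n powr \<alpha>"
    using n_rho_prop by blast
  have "eventually (\<lambda>n. \<gamma> n < 1) sequentially"
    using order_tendstoD(2)[OF step_tendsto[OF steps], of 1] by simp
  then obtain M where M: "\<And>n. M \<le> n \<Longrightarrow> \<gamma> n < 1" by (auto simp: eventually_sequentially)
  \<comment> \<open>Beyond \<open>M0\<close> all steps are below 1 and both comparison properties
    hold; the entry 1 keeps out the meaningless step \<open>\<gamma> 0\<close>.\<close>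
  define M0 where "M0 = Max {1, M, n_star, n_rho}"
  have M0: "1 \<le> M0" "M \<le> M0" "n_star \<le> M0" "n_rho \<le> M0" by (auto simp: M0_def)
  \<comment> \<open>Going back one unit twice overshoots by less than a step, hence by less than 1,
    each time; 4 units of room keep all indices involved beyond \<open>M0\<close>.\<close>
  have "eventually (\<lambda>n. Gam \<gamma> M0 + 4 \<le> Gam \<gamma> n) sequentially"
    using Gam_tendsto[OF steps] unfolding filterlim_at_top by blast
  then obtain n0 where n0: "\<And>n. n0 \<le> n \<Longrightarrow> Gam \<gamma> M0 + 4 \<le> Gam \<gamma> n" by (auto simp: eventually_sequentially)
  \<comment> \<open>The factor from \<open>n_star_prop\<close> over a time span below 4; the
    absolute value covers either sign of \<open>\<omega>\<close>.\<close>
  define L where "L = exp (2 * \<bar>\<omega>\<bar> * 4)"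
  have L: "1 \<le> L" by (simp add: L_def)
  let ?\<theta> = "min (p * \<beta>) \<alpha> - \<epsilon>"
  \<comment> \<open>The three constants belong to the two mollification errors, to the one-step
    errors after \<Gamma>_m on the mollified function, and to the one-step errors up to
    \<Gamma>_m.\<close>
  let ?Ca = "2 * c5 * (2 + L powr (\<beta> * p))"
  let ?Cb = "c1 * (c2 * A) * (2 * L powr \<alpha>)"
  let ?Cc = "c1 * D * \<bar>C6\<bar>"
  show thesis
  proof (rule that)
    show "0 \<le> ?Ca + ?Cb + ?Cc" using c1 c2 c5 A(1) D(1) by simp
    fix f :: "real ^ 'd \<Rightarrow> real" and S :: real and n :: nat and x
    assume n: "n0 \<le> n" and f: "f \<in> Mb" and fS: "sup_norm f = ennreal S" and S0: "0 \<le> S"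
    have S: "\<bar>f y\<bar> \<le> S" for y using sup_norm_le_iff[OF S0, of f] fS by auto
    define m where "m = Nidx \<gamma> (Gam \<gamma> n - 1)"
    \<comment> \<open>In \<open>h5\<close> with t = \<Gamma>_m and r = \<Gamma>_n, the leading Euler
      operator starts at \<Gamma>_j, because the scheme rounds t - 1 down to the grid.\<close>
    define j where "j = Nidx \<gamma> (Gam \<gamma> m - 1)"
    have G0: "0 \<le> Gam \<gamma> i" for i by (rule Gam_nonneg[OF steps])
    note Gn = n0[OF n]
    have m: "Gam \<gamma> m \<le> Gam \<gamma> n - 1" "Gam \<gamma> n - 1 < Gam \<gamma> (Suc m)"
      unfolding m_def by (intro Nidx_bounds[OF steps]; use Gn G0[of M0] in linarith)+
    have "Gam \<gamma> M0 < Gam \<gamma> (Suc m)" using m Gn by linarith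
    then have Mm: "M0 \<le> m" unfolding Gl by simp
    then have "\<gamma> (Suc m) < 1" using M M0 by simp
    then have Gm: "Gam \<gamma> n - 2 < Gam \<gamma> m" using m by (simp add: Gam_Suc)
    have j: "Gam \<gamma> j \<le> Gam \<gamma> m - 1" "Gam \<gamma> m - 1 < Gam \<gamma> (Suc j)"
      unfolding j_def by (intro Nidx_bounds[OF steps]; use Gn Gm G0[of M0] in linarith)+
    have "Gam \<gamma> M0 < Gam \<gamma> (Suc j)" using j Gm Gn by linarith
    then have Mj: "M0 \<le> j" unfolding Gl by simp
    then have "\<gamma> (Suc j) < 1" using M M0 by simp
    then have Gj: "Gam \<gamma> n - 4 < Gam \<gamma> j" using j Gm by (simp add: Gam_Suc)
    have "Gam \<gamma> j < Gam \<gamma> m" "Gam \<gamma> m < Gam \<gamma> n" using j m by linarith+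
    then have jmn: "j < m" "m < n" by (simp_all add: Gl)
    define g where "g = \<gamma> n"
    have g: "0 < g" "g < 1"
      using step_pos[OF steps, of n] M[of n] M0 Mm jmn by (auto simp: g_def)
    have \<gamma>L: "\<gamma> i \<le> L * g" if i: "j \<le> i" "i \<le> n" for i
    proof -
      have "\<gamma> i \<le> \<gamma> j" using Mj M0 i by (intro step_antimono[OF steps]) auto
      also have "\<gamma> j \<le> exp (2 * \<omega> * (Gam \<gamma> n - Gam \<gamma> j)) * g"
        unfolding g_def using n_star_prop Mj M0 i by auto
      also have "\<dots> \<le> L * g"
      proof -
        have "\<omega> * (Gam \<gamma> n - Gam \<gamma> j) \<le> \<bar>\<omega>\<bar> * 4"
          using Gj jmn Gl(2)[of j n] by (intro mult_mono) auto
        then show ?thesis using g unfolding L_def by (intro mult_right_mono) auto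
      qed
      finally show ?thesis .
    qed
    have \<gamma>0: "0 < \<gamma> i" if "1 \<le> i" for i using step_pos[OF steps that] .
    define \<delta> where "\<delta> = g powr e1"
    define \<eta> where "\<eta> = g powr e2"
    have \<delta>: "0 < \<delta>" "\<delta> \<le> 1" and \<eta>: "0 < \<eta>"
      using g e1(2) by (auto simp: \<delta>_def \<eta>_def intro!: powr_le1)
    define f' where "f' = regularize \<phi> \<delta> f"
    define G where "G = A * S / \<delta> ^ Suc k\<^sub>0"
    have f': "f' \<in> Cb (Suc k\<^sub>0)" "Ck_norm k\<^sub>0 (grad f') \<le> ennreal G"
      using A(2)[of f S \<delta>] f S \<delta> by (auto simp: Mb_def f'_def G_def)
    have f'M: "f' \<in> Mb" using f'(1) by (rule Cb_Suc_in_Mb)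
    have GG: "0 \<le> G" using A S0 \<delta> by (simp add: G_def)
    define u where "u = Gam \<gamma> n - Gam \<gamma> m"
    have u: "1 \<le> u" "u < 2" using m Gm by (simp_all add: u_def)
    define B where "B = \<delta> ^ q / \<eta> ^ (2 * q) + \<eta> powr (- p) * \<gamma> j powr (\<beta> * p) + \<eta> ^ \<kappa>"
    have B0: "0 \<le> B" using \<delta> \<eta> by (simp add: B_def)
    have PuM: "kernel_op (P u) h \<in> Mb" if "h \<in> Mb" for h
      using u that by (intro kernel_op_in_Mb kernel_P) auto
    have EM: "euler_op Q \<gamma> a b h \<in> Mb" if "a \<le> b" "h \<in> Mb" for a b h
      using that by (rule euler_op_in_Mb)
    let ?E = "euler_op Q \<gamma>"
    let ?a = "\<lambda>y. ?E j m (kernel_op (P u) f) y - ?E j m (kernel_op (P u) f') y"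
    let ?b = "\<lambda>y. ?E j m (?E m n f) y - ?E j m (?E m n f') y"
    have "sup_norm ?a + sup_norm ?b \<le> ennreal C5 * ennreal B * sup_norm f"
    proof -
      have e1: "kernel_op (euler Q \<gamma> (Gam \<gamma> m - 1) (Gam \<gamma> m)) h = ?E j m h" if "h \<in> Mb" for h
        using euler_eq_euler_op[OF that, of "Gam \<gamma> m - 1" "Gam \<gamma> m"] by (simp add: j_def Nidx_Gam[OF steps])
      have e2: "kernel_op (euler Q \<gamma> (Gam \<gamma> m) (Gam \<gamma> n)) h = ?E m n h" if "h \<in> Mb" for h
        using euler_eq_euler_op[OF that, of "Gam \<gamma> m" "Gam \<gamma> n"] by (simp add: Nidx_Gam[OF steps])
      have c: "1 < Gam \<gamma> m \<and> Gam \<gamma> m < Gam \<gamma> n \<and> Gam \<gamma> n < Gam \<gamma> m + 2 \<and> Nidx \<gamma> (Gam \<gamma> m - 1) \<ge> 1"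
        using Gm m Gn G0[of M0] Mj M0(1) by (auto simp flip: j_def)
      have "ennreal C5 * ennreal B * sup_norm f \<ge>
        sup_norm (\<lambda>x. kernel_op (euler Q \<gamma> (Gam \<gamma> m - 1) (Gam \<gamma> m)) (kernel_op (P u) f) x
            - kernel_op (euler Q \<gamma> (Gam \<gamma> m - 1) (Gam \<gamma> m)) (kernel_op (P u) f') x)
        + sup_norm (\<lambda>x. kernel_op (euler Q \<gamma> (Gam \<gamma> m - 1) (Gam \<gamma> m)) (kernel_op (euler Q \<gamma> (Gam \<gamma> m) (Gam \<gamma> n)) f) x
            - kernel_op (euler Q \<gamma> (Gam \<gamma> m - 1) (Gam \<gamma> m)) (kernel_op (euler Q \<gamma> (Gam \<gamma> m) (Gam \<gamma> n)) f') x)"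
        using C5[rule_format, OF \<delta>(1) \<eta> rangeI rangeI f c] unfolding u_def f'_def B_def j_def by simp
      then show ?thesis using jmn by (simp add: e1 e2 PuM EM f f'M)
    qed
    also have "\<dots> \<le> ennreal (c5 * (B * S))"
      using ennreal_mult_le[of "ennreal B * sup_norm f" "B * S" C5] B0 S0
      by (simp add: fS c5_def mult.assoc flip: ennreal_mult)
    finally have sum_le: "sup_norm ?a + sup_norm ?b \<le> ennreal (c5 * (B * S))" .
    have cBS: "0 \<le> c5 * (B * S)" using c5 B0 S0 by simp
    have "sup_norm ?a \<le> ennreal (c5 * (B * S))"
      by (rule order_trans[OF _ sum_le]) (simp add: add_increasing2)
    then have a: "\<bar>?a y\<bar> \<le> c5 * (B * S)" for y unfolding sup_norm_le_iff[OF cBS] by simp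
    have "sup_norm ?b \<le> ennreal (c5 * (B * S))"
      by (rule order_trans[OF _ sum_le]) (simp add: add_increasing)
    then have b: "\<bar>?b y\<bar> \<le> c5 * (B * S)" for y unfolding sup_norm_le_iff[OF cBS] by simp
    have "B = (g powr e1) ^ q / (g powr e2) ^ (2 * q) + (g powr e2) powr (- p) * \<gamma> j powr (\<beta> * p) + (g powr e2) ^ \<kappa>"
      by (simp add: B_def \<delta>_def \<eta>_def)
    also have "\<dots> \<le> (g powr e1) ^ q / (g powr e2) ^ (2 * q) + (g powr e2) powr (- p) * (L * g) powr (\<beta> * p) + (g powr e2) ^ \<kappa>"
      using \<gamma>L[of j] \<gamma>0[of j] jmn Mj M0 beta p
      by (intro add_mono mult_left_mono powr_mono2) auto
    also have "\<dots> \<le> (2 + L powr (\<beta> * p)) * g powr ?\<theta>" using par g L by simp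
    finally have B: "B \<le> (2 + L powr (\<beta> * p)) * g powr ?\<theta>" .
    \<comment> \<open>After any step i > m at most one unit of time remains, during which
      \<open>P\<close> preserves the smoothness of \<open>f'\<close>. These steps sum to less than
      2, and the factor \<open>1 / \<delta> ^ Suc k\<^sub>0\<close> is exactly
      g^(-\<epsilon>).\<close>
    have smooth: "\<bar>?E m n f' y - kernel_op (P u) f' y\<bar> \<le> ?Cb * S * g powr ?\<theta>" for y
    proof -
      have "\<bar>?E m n f' y - kernel_op (P u) f' y\<bar> \<le> (\<Sum>i\<in>{m<..n}. c1 * (c2 * G) * \<gamma> i powr (1 + \<alpha>))"
        unfolding u_def
      proof (rule euler_op_error)
        fix i z assume i: "m < i" "i \<le> n"
        have "Gam \<gamma> (Suc m) \<le> Gam \<gamma> i" "Gam \<gamma> i \<le> Gam \<gamma> n" using i by (simp_all add: Gl)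
        then have s: "0 \<le> Gam \<gamma> n - Gam \<gamma> i" "Gam \<gamma> n - Gam \<gamma> i \<le> 1" using m by linarith+
        show "\<bar>kernel_op (P (\<gamma> i)) (kernel_op (P (Gam \<gamma> n - Gam \<gamma> i)) f') z
          - kernel_op (Q (\<gamma> i)) (kernel_op (P (Gam \<gamma> n - Gam \<gamma> i)) f') z\<bar> \<le> c1 * (c2 * G) * \<gamma> i powr (1 + \<alpha>)"
          by (rule one_step_error[OF \<gamma>0 kernel_op_in_Mb[OF kernel_P[OF s(1)] f'M] short_time[OF s f' GG]])
            (use i c2 GG in auto)
      qed (use jmn f'M in auto)
      also have "\<dots> \<le> (\<Sum>i\<in>{m<..n}. c1 * (c2 * G) * ((L * g) powr \<alpha> * \<gamma> i))"
      proof (intro sum_mono mult_left_mono)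
        fix i assume i: "i \<in> {m<..n}"
        have "\<gamma> i powr (1 + \<alpha>) = \<gamma> i powr \<alpha> * \<gamma> i" using i \<gamma>0[of i] by (simp add: powr_add)
        also have "\<dots> \<le> (L * g) powr \<alpha> * \<gamma> i"
          using i jmn \<gamma>0[of i] alpha by (intro mult_right_mono powr_mono2 \<gamma>L) auto
        finally show "\<gamma> i powr (1 + \<alpha>) \<le> (L * g) powr \<alpha> * \<gamma> i" .
      qed (use c1 c2 GG in auto)
      also have "\<dots> = c1 * (c2 * G) * (L * g) powr \<alpha> * (\<Sum>i\<in>{m<..n}. \<gamma> i)"
        by (simp add: sum_distrib_left mult.assoc)
      also have "(\<Sum>i\<in>{m<..n}. \<gamma> i) = u"
      proof -
        have "{1..n} = {1..m} \<union> {m<..n}" using jmn by auto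
        then have "Gam \<gamma> n = Gam \<gamma> m + (\<Sum>i\<in>{m<..n}. \<gamma> i)"
          unfolding Gam_def by (subst sum.union_disjoint[symmetric]) auto
        then show ?thesis by (simp add: u_def)
      qed
      also have "c1 * (c2 * G) * (L * g) powr \<alpha> * u \<le> c1 * (c2 * G) * (L * g) powr \<alpha> * 2"
        using u c1 c2 GG by (intro mult_left_mono) auto
      also have "\<dots> = ?Cb * S * (g powr \<alpha> / \<delta> ^ Suc k\<^sub>0)"
        using g L by (simp add: G_def powr_mult del: power_Suc)
      also have "g powr \<alpha> / \<delta> ^ Suc k\<^sub>0 = g powr (\<alpha> - \<epsilon>)"
      proof -
        have "\<delta> ^ Suc k\<^sub>0 = g powr (e1 * (real k\<^sub>0 + 1))"
          unfolding \<delta>_def using g by (simp add: powr_powr add.commute flip: powr_realpow del: power_Suc)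
        then show ?thesis by (simp add: e1 powr_diff)
      qed
      also have "?Cb * S * g powr (\<alpha> - \<epsilon>) \<le> ?Cb * S * g powr ?\<theta>"
        using g c1 c2 A(1) S0 by (intro mult_left_mono powr_mono') auto
      finally show ?thesis .
    qed
    \<comment> \<open>Triangle inequality through \<open>f'\<close>. The operator from j to m stays
      in front throughout, because only behind it are the two mollification errors known to be
      small; on the middle term it merely contracts.\<close>
    have late: "\<bar>?E j m (?E m n f) y - ?E j m (kernel_op (P u) f) y\<bar> \<le> (?Ca + ?Cb) * S * g powr ?\<theta>" for y
    proof -
      have "\<bar>?E j m (?E m n f') y - ?E j m (kernel_op (P u) f') y\<bar> \<le> ?Cb * S * g powr ?\<theta>"
        using jmn by (intro euler_op_contraction EM PuM f'M smooth) auto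
      then have "\<bar>?E j m (?E m n f) y - ?E j m (kernel_op (P u) f) y\<bar> \<le> 2 * (c5 * (B * S)) + ?Cb * S * g powr ?\<theta>"
        using a[of y] b[of y] by linarith
      also have "\<dots> \<le> 2 * (c5 * ((2 + L powr (\<beta> * p)) * g powr ?\<theta> * S)) + ?Cb * S * g powr ?\<theta>"
        using B c5 S0 by (intro add_right_mono mult_left_mono mult_right_mono) auto
      also have "\<dots> = (?Ca + ?Cb) * S * g powr ?\<theta>" by (simp add: algebra_simps)
      finally show ?thesis .
    qed
    have "\<bar>?E 0 j (?E j m (?E m n f)) x - ?E 0 j (?E j m (kernel_op (P u) f)) x\<bar> \<le> (?Ca + ?Cb) * S * g powr ?\<theta>"
      using jmn by (intro euler_op_contraction EM PuM f late) auto
    then have part1: "\<bar>?E 0 n f x - ?E 0 m (kernel_op (P u) f) x\<bar> \<le> (?Ca + ?Cb) * S * g powr ?\<theta>"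
      using jmn euler_op_comp[of 0 j m Q \<gamma> "?E m n f"] euler_op_comp[of 0 m n Q \<gamma> f]
        euler_op_comp[of 0 j m Q \<gamma> "kernel_op (P u) f"] by simp
    \<comment> \<open>The telescoping stops at m, but composing with \<open>P u\<close> leaves at
      least one unit of time after every step, so the smoothing bound applies to f itself with decay
      over \<Gamma>_n - \<Gamma>_i.\<close>
    have "\<bar>?E 0 m (kernel_op (P u) f) x - kernel_op (P (Gam \<gamma> m - Gam \<gamma> 0)) (kernel_op (P u) f) x\<bar>
        \<le> (\<Sum>i\<in>{0<..m}. c1 * (D * S * exp (- \<rho> * (Gam \<gamma> n - Gam \<gamma> i))) * \<gamma> i powr (1 + \<alpha>))"
    proof (rule euler_op_error)
      fix i z assume i: "0 < i" "i \<le> m"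
      have "Gam \<gamma> i \<le> Gam \<gamma> m" using i by (simp add: Gl)
      then have s: "1 \<le> Gam \<gamma> n - Gam \<gamma> i" "0 \<le> Gam \<gamma> m - Gam \<gamma> i" using m by linarith+
      have eq: "kernel_op (P (Gam \<gamma> m - Gam \<gamma> i)) (kernel_op (P u) f) = kernel_op (P (Gam \<gamma> n - Gam \<gamma> i)) f"
        using s u f by (subst P_add) (auto simp: u_def)
      show "\<bar>kernel_op (P (\<gamma> i)) (kernel_op (P (Gam \<gamma> m - Gam \<gamma> i)) (kernel_op (P u) f)) z
          - kernel_op (Q (\<gamma> i)) (kernel_op (P (Gam \<gamma> m - Gam \<gamma> i)) (kernel_op (P u) f)) z\<bar>
          \<le> c1 * (D * S * exp (- \<rho> * (Gam \<gamma> n - Gam \<gamma> i))) * \<gamma> i powr (1 + \<alpha>)"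
        unfolding eq
        by (rule one_step_error[OF \<gamma>0 kernel_op_in_Mb[OF kernel_P f] D(2)[OF s(1) f S]])
           (use i s D(1) S0 in auto)
    qed (use PuM f in auto)
    \<comment> \<open>Nonnegative terms up to n are added to reach the weighted sum that
      \<open>n_rho_prop\<close> controls.\<close>
    also have "\<dots> \<le> (\<Sum>i=1..n. c1 * (D * S * exp (- \<rho> * (Gam \<gamma> n - Gam \<gamma> i))) * \<gamma> i powr (1 + \<alpha>))"
      using jmn c1 D(1) S0 by (intro sum_mono2) auto
    also have "\<dots> = c1 * D * S * (\<Sum>i=1..n. \<gamma> i powr (1 + \<alpha>) * exp (- \<rho> * (Gam \<gamma> n - Gam \<gamma> i)))"
      by (simp add: sum_distrib_left mult_ac)
    also have "\<dots> \<le> c1 * D * S * (\<bar>C6\<bar> * g powr \<alpha>)"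
    proof (intro mult_left_mono)
      have "(\<Sum>i=1..n. \<gamma> i powr (1 + \<alpha>) * exp (- \<rho> * (Gam \<gamma> n - Gam \<gamma> i))) \<le> C6 * g powr \<alpha>"
        unfolding g_def using Mm jmn M0 by (intro C6) auto
      also have "\<dots> \<le> \<bar>C6\<bar> * g powr \<alpha>" by (intro mult_right_mono) auto
      finally show "(\<Sum>i=1..n. \<gamma> i powr (1 + \<alpha>) * exp (- \<rho> * (Gam \<gamma> n - Gam \<gamma> i))) \<le> \<bar>C6\<bar> * g powr \<alpha>" .
    qed (use c1 D(1) S0 in auto)
    also have "\<dots> \<le> c1 * D * S * (\<bar>C6\<bar> * g powr ?\<theta>)"
      using g c1 D(1) S0 eps by (intro mult_left_mono powr_mono') auto
    also have "\<dots> = ?Cc * S * g powr ?\<theta>" by simp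
    finally have "\<bar>?E 0 m (kernel_op (P u) f) x - kernel_op (P (Gam \<gamma> m - Gam \<gamma> 0)) (kernel_op (P u) f) x\<bar>
        \<le> ?Cc * S * g powr ?\<theta>" .
    moreover have "kernel_op (P (Gam \<gamma> m - Gam \<gamma> 0)) (kernel_op (P u) f) x = kernel_op (P (Gam \<gamma> n)) f x"
      using G0[of m] u f by (subst P_add) (auto simp: u_def Gam_0)
    ultimately show "\<bar>?E 0 n f x - kernel_op (P (Gam \<gamma> n)) f x\<bar> \<le> (?Ca + ?Cb + ?Cc) * S * \<gamma> n powr ?\<theta>"
      using part1 unfolding g_def[symmetric] distrib_right[of "?Ca + ?Cb" ?Cc] distrib_right[of _ _ S]
        distrib_right[of _ _ "g powr ?\<theta>"] by linarith
  qed
qed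

lemma euler_error:
  assumes ev: "\<And>f S n x. n0 \<le> n \<Longrightarrow> f \<in> Mb \<Longrightarrow> sup_norm f = ennreal S \<Longrightarrow> 0 \<le> S \<Longrightarrow>
      \<bar>euler_op Q \<gamma> 0 n f x - kernel_op (P (Gam \<gamma> n)) f x\<bar> \<le> C * S * \<gamma> n powr \<theta>"
    and C: "0 \<le> C"
  obtains K where "0 \<le> K"
    "\<And>f S n x. 1 \<le> n \<Longrightarrow> f \<in> Mb \<Longrightarrow> sup_norm f = ennreal S \<Longrightarrow> 0 \<le> S \<Longrightarrow>
      \<bar>kernel_op (euler Q \<gamma> 0 (Gam \<gamma> n)) f x - kernel_op (P (Gam \<gamma> n)) f x\<bar> \<le> K * S * \<gamma> n powr \<theta>"
proof -
  \<comment> \<open>Each of the finitely many early indices contributes its own term, so that the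
    trivial bound 2S from contraction suffices there.\<close>
  define K where "K = C + (\<Sum>i=1..n0. 2 / \<gamma> i powr \<theta>)"
  have pos: "0 \<le> (\<Sum>i=1..n0. 2 / \<gamma> i powr \<theta>)" by (intro sum_nonneg) auto
  show thesis
  proof (rule that)
    show "0 \<le> K" using C pos by (simp add: K_def)
    fix f :: "real ^ 'd \<Rightarrow> real" and S :: real and n :: nat and x
    assume n: "1 \<le> n" and f: "f \<in> Mb" and fS: "sup_norm f = ennreal S" and S0: "0 \<le> S"
    have e: "kernel_op (euler Q \<gamma> 0 (Gam \<gamma> n)) f = euler_op Q \<gamma> 0 n f"
      using euler_eq_euler_op[OF f, of 0 "Gam \<gamma> n"] Nidx_Gam[OF steps, of 0] Nidx_Gam[OF steps, of n]
      by (simp add: Gam_0)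
    show "\<bar>kernel_op (euler Q \<gamma> 0 (Gam \<gamma> n)) f x - kernel_op (P (Gam \<gamma> n)) f x\<bar> \<le> K * S * \<gamma> n powr \<theta>"
    proof (cases "n0 \<le> n")
      case True
      have "C * S * \<gamma> n powr \<theta> \<le> K * S * \<gamma> n powr \<theta>"
        using S0 pos by (intro mult_right_mono) (auto simp: K_def)
      with ev[OF True f fS S0, of x] show ?thesis unfolding e by linarith
    next
      case False
      have S: "\<bar>f y\<bar> \<le> S" for y using sup_norm_le_iff[OF S0, of f] fS by auto
      have "0 < \<gamma> n powr \<theta>" using step_pos[OF steps n] by simp
      have "2 / \<gamma> n powr \<theta> \<le> (\<Sum>i=1..n0. 2 / \<gamma> i powr \<theta>)"
        using n False by (intro member_le_sum) auto
      then have "2 / \<gamma> n powr \<theta> \<le> K" using C by (simp add: K_def)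
      then have "2 \<le> K * \<gamma> n powr \<theta>" using \<open>0 < \<gamma> n powr \<theta>\<close> by (simp add: field_simps)
      from mult_right_mono[OF this S0] have "2 * S \<le> K * S * \<gamma> n powr \<theta>" by (simp add: mult_ac)
      moreover have "\<bar>kernel_op (euler Q \<gamma> 0 (Gam \<gamma> n)) f x\<bar> \<le> S"
        by (intro kernel_op_bound prob_kernel_euler f S)
      moreover have "\<bar>kernel_op (P (Gam \<gamma> n)) f x\<bar> \<le> S"
        by (intro kernel_op_bound kernel_P f S Gam_nonneg[OF steps])
      ultimately show ?thesis by linarith
    qed
  qed
qed

end

theorem proposition2p1p1:
  fixes P Q :: "real \<Rightarrow> real ^ 'd::finite \<Rightarrow> (real ^ 'd) measure"
    and \<gamma> :: "nat \<Rightarrow> real"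
    and \<phi> :: "real ^ 'd \<Rightarrow> real"
    and \<alpha> \<beta> p \<rho> :: real
    and k\<^sub>0 n_rho n_star :: nat
  assumes semigroup: "markov_semigroup P"
    and one_step: "one_step_operators Q"
    and steps: "step_sequence \<gamma>"
    and kernel: "super_kernel \<phi>"
    and beta: "\<beta> > 0" and p: "p \<ge> 1" and alpha: "\<alpha> > 0"
    and h1: "\<exists>C::real. \<forall>h>0. \<forall>f\<in>Cb (k\<^sub>0 + 1).
        sup_norm (\<lambda>x. kernel_op (P h) f x - kernel_op (Q h) f x)
          \<le> ennreal C * Ck_norm k\<^sub>0 (grad f) * ennreal (h powr (1 + \<alpha>))"
    and h2: "\<forall>k\<ge>1. \<exists>C::real. \<forall>f\<in>Mb. \<forall>t\<in>{1..2}.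
        grad_estimate (k - 1) (kernel_op (P t) f) (ennreal C * sup_norm f)"
    and h3: "\<forall>k\<ge>1. \<exists>C::real. \<forall>f\<in>Cb 1. \<forall>t\<in>{1..2}.
        grad_estimate (k - 1) (kernel_op (P t) f) (ennreal C * sup_norm (grad f))"
    and rho: "\<rho> > 0" "\<rho> > \<alpha> * omega_bar \<gamma>"
    and h4: "\<forall>k. \<exists>C::real. \<forall>f\<in>Cb (k + 1).
        (\<forall>t\<ge>1. grad_estimate 0 (kernel_op (P t) f)
            (ennreal C * Ck_norm k (grad f) * ennreal (exp (- \<rho> * t)))) \<and>
        (\<forall>t. 0 < t \<and> t \<le> 1 \<longrightarrow>
          grad_estimate k (kernel_op (P t) f) (ennreal C * Ck_norm k (grad f)))"
    and h5: "\<forall>q \<kappa> :: nat. \<exists>C::real. \<forall>\<delta>>0. \<forall>\<eta>>0. \<forall>t\<in>range (Gam \<gamma>). \<forall>r\<in>range (Gam \<gamma>). \<forall>f\<in>Mb.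
        1 < t \<and> t < r \<and> r < t + 2 \<and> Nidx \<gamma> (t - 1) \<ge> 1 \<longrightarrow>
        sup_norm (\<lambda>x. kernel_op (euler Q \<gamma> (t - 1) t) (kernel_op (P (r - t)) f) x
            - kernel_op (euler Q \<gamma> (t - 1) t) (kernel_op (P (r - t)) (regularize \<phi> \<delta> f)) x)
        + sup_norm (\<lambda>x. kernel_op (euler Q \<gamma> (t - 1) t) (kernel_op (euler Q \<gamma> t r) f) x
            - kernel_op (euler Q \<gamma> (t - 1) t) (kernel_op (euler Q \<gamma> t r) (regularize \<phi> \<delta> f)) x)
        \<le> ennreal C * ennreal (\<delta> ^ q / \<eta> ^ (2 * q)
              + \<eta> powr (- p) * \<gamma> (Nidx \<gamma> (t - 1)) powr (\<beta> * p) + \<eta> ^ \<kappa>) * sup_norm f"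
    and n_rho_prop: "\<exists>C::real. \<forall>n\<ge>n_rho. n \<ge> 1 \<longrightarrow>
        (\<Sum>i=1..n. \<gamma> i powr (1 + \<alpha>) * exp (- \<rho> * (Gam \<gamma> n - Gam \<gamma> i))) \<le> C * \<gamma> n powr \<alpha>"
    and n_star_prop: "\<forall>i n. 1 \<le> i \<and> n_star \<le> i \<and> i \<le> n \<longrightarrow>
        \<gamma> i \<le> exp (2 * omega_bar \<gamma> * (Gam \<gamma> n - Gam \<gamma> i)) * \<gamma> n"
  shows "(\<forall>\<epsilon>>0. \<exists>C::real. \<forall>f\<in>Mb. \<forall>n.
            3 \<le> Gam \<gamma> n \<and> Nidx \<gamma> (Gam \<gamma> n - 3) > n_star \<and> Nidx \<gamma> (Gam \<gamma> n - 2) > n_rho + 1 \<longrightarrow>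
            sup_norm (\<lambda>x. kernel_op (euler Q \<gamma> 0 (Gam \<gamma> n)) f x - kernel_op (P (Gam \<gamma> n)) f x)
              \<le> ennreal C * sup_norm f * ennreal (\<gamma> n powr (min (p * \<beta>) \<alpha> - \<epsilon>)))
       \<and> (\<forall>\<nu>. invariant_prob P \<nu> \<longrightarrow>
            (\<forall>\<nu>'. invariant_prob P \<nu>' \<longrightarrow> \<nu>' = \<nu>) \<and>
            (\<forall>\<epsilon>>0. \<exists>C::real. \<forall>x. \<forall>n.
               3 \<le> Gam \<gamma> n \<and> Nidx \<gamma> (Gam \<gamma> n - 3) > n_star \<and> Nidx \<gamma> (Gam \<gamma> n - 2) > n_rho + 1 \<longrightarrow>
               tv_dist (euler Q \<gamma> 0 (Gam \<gamma> n) x) \<nu>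
                 \<le> ennreal C * (ennreal (\<gamma> n powr (min (p * \<beta>) \<alpha> - \<epsilon>))
                     + (\<integral>\<^sup>+y. ennreal (dist x y) \<partial>\<nu>) * ennreal (exp (- \<rho> * Gam \<gamma> n)))))"
proof -
  interpret euler_scheme P Q \<gamma>
    by unfold_locales (fact semigroup one_step steps)+
  have h4': "\<exists>C::real. \<forall>f\<in>Cb 1. \<forall>t\<ge>1. grad_estimate 0 (kernel_op (P t) f)
            (ennreal C * Ck_norm 0 (grad f) * ennreal (exp (- \<rho> * t)))"
    using h4[rule_format, of 0] by auto
  have h4'': "\<exists>C::real. \<forall>f\<in>Cb (k\<^sub>0 + 1). \<forall>t. 0 < t \<and> t \<le> 1 \<longrightarrow>
          grad_estimate k\<^sub>0 (kernel_op (P t) f) (ennreal C * Ck_norm k\<^sub>0 (grad f))"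
    using h4[rule_format, of k\<^sub>0] by blast
  obtain D where D: "0 \<le> D"
    "\<And>s f S. 1 \<le> s \<Longrightarrow> f \<in> Mb \<Longrightarrow> (\<And>x. \<bar>f x\<bar> \<le> S) \<Longrightarrow>
      grad_estimate k\<^sub>0 (kernel_op (P s) f) (ennreal (D * S * exp (- \<rho> * s)))"
    using smoothing_decay[OF h2 h3 h4' rho(1)] by blast
  \<comment> \<open>Decay at order zero yields a Lipschitz bound whose constant decays in time, as
    both statements on invariant measures require.\<close>
  obtain D\<^sub>0 where D\<^sub>0: "0 \<le> D\<^sub>0"
    "\<And>s f S. 1 \<le> s \<Longrightarrow> f \<in> Mb \<Longrightarrow> (\<And>x. \<bar>f x\<bar> \<le> S) \<Longrightarrow>
      grad_estimate 0 (kernel_op (P s) f) (ennreal (D\<^sub>0 * S * exp (- \<rho> * s)))"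
    using smoothing_decay[OF h2 h3 h4' rho(1)] by blast
  have lip: "\<bar>kernel_op (P t) f x - kernel_op (P t) f y\<bar> \<le> D\<^sub>0 * S * exp (- \<rho> * t) * dist x y"
    if t: "1 \<le> t" and f: "f \<in> Mb" and S: "\<And>x. \<bar>f x\<bar> \<le> S" for t f S x y
  proof (rule sup_norm_grad_lipschitz)
    have g: "grad_estimate 0 (kernel_op (P t) f) (ennreal (D\<^sub>0 * S * exp (- \<rho> * t)))"
      by (rule D\<^sub>0(2)[OF t f S])
    then show "sup_norm (grad (kernel_op (P t) f)) \<le> ennreal (D\<^sub>0 * S * exp (- \<rho> * t))"
      by (simp add: grad_estimate_def Ck_norm_0)
    show "kernel_op (P t) f differentiable (at z)" for z
      using g by (simp add: grad_estimate_def)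
    show "0 \<le> D\<^sub>0 * S * exp (- \<rho> * t)"
      using D\<^sub>0(1) S[of undefined] by simp
  qed
  have err: "\<exists>K\<ge>0. \<forall>f S n x. 1 \<le> n \<longrightarrow> f \<in> Mb \<longrightarrow> sup_norm f = ennreal S \<longrightarrow> 0 \<le> S \<longrightarrow>
      \<bar>kernel_op (euler Q \<gamma> 0 (Gam \<gamma> n)) f x - kernel_op (P (Gam \<gamma> n)) f x\<bar>
        \<le> K * S * \<gamma> n powr (min (p * \<beta>) \<alpha> - \<epsilon>)" if eps: "\<epsilon> > 0" for \<epsilon>
  proof -
    obtain C n0 where C: "0 \<le> C"
      "\<And>f S n x. n0 \<le> n \<Longrightarrow> f \<in> Mb \<Longrightarrow> sup_norm f = ennreal S \<Longrightarrow> 0 \<le> S \<Longrightarrow>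
      \<bar>euler_op Q \<gamma> 0 n f x - kernel_op (P (Gam \<gamma> n)) f x\<bar> \<le> C * S * \<gamma> n powr (min (p * \<beta>) \<alpha> - \<epsilon>)"
      using euler_error_eventually[OF kernel beta p alpha eps h1 D h4'' h5 n_rho_prop n_star_prop] by blast
    show ?thesis by (rule euler_error[OF C(2) C(1)]) blast+
  qed
  have n1: "1 \<le> n" if "3 \<le> Gam \<gamma> n" for n
    using that by (cases n) (auto simp: Gam_0)
  show ?thesis
  proof (intro conjI allI impI)
    fix \<epsilon> :: real assume "\<epsilon> > 0"
    from err[OF this] obtain K where K: "0 \<le> K"
      "\<And>f S n x. 1 \<le> n \<Longrightarrow> f \<in> Mb \<Longrightarrow> sup_norm f = ennreal S \<Longrightarrow> 0 \<le> S \<Longrightarrow>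
      \<bar>kernel_op (euler Q \<gamma> 0 (Gam \<gamma> n)) f x - kernel_op (P (Gam \<gamma> n)) f x\<bar>
        \<le> K * S * \<gamma> n powr (min (p * \<beta>) \<alpha> - \<epsilon>)" by blast
    show "\<exists>C::real. \<forall>f\<in>Mb. \<forall>n.
            3 \<le> Gam \<gamma> n \<and> Nidx \<gamma> (Gam \<gamma> n - 3) > n_star \<and> Nidx \<gamma> (Gam \<gamma> n - 2) > n_rho + 1 \<longrightarrow>
            sup_norm (\<lambda>x. kernel_op (euler Q \<gamma> 0 (Gam \<gamma> n)) f x - kernel_op (P (Gam \<gamma> n)) f x)
              \<le> ennreal C * sup_norm f * ennreal (\<gamma> n powr (min (p * \<beta>) \<alpha> - \<epsilon>))"
    proof (intro exI[of _ K] ballI allI impI)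
      fix f :: "real ^ 'd \<Rightarrow> real" and n assume f: "f \<in> Mb"
        and n: "3 \<le> Gam \<gamma> n \<and> Nidx \<gamma> (Gam \<gamma> n - 3) > n_star \<and> Nidx \<gamma> (Gam \<gamma> n - 2) > n_rho + 1"
      obtain S where S: "0 \<le> S" "sup_norm f = ennreal S" using f by (rule MbE)
      have "sup_norm (\<lambda>x. kernel_op (euler Q \<gamma> 0 (Gam \<gamma> n)) f x - kernel_op (P (Gam \<gamma> n)) f x)
          \<le> ennreal (K * S * \<gamma> n powr (min (p * \<beta>) \<alpha> - \<epsilon>))"
        using K S n1 n f by (subst sup_norm_le_iff) auto
      also have "\<dots> = ennreal K * sup_norm f * ennreal (\<gamma> n powr (min (p * \<beta>) \<alpha> - \<epsilon>))"
        using K(1) S by (simp add: ennreal_mult)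
      finally show "sup_norm (\<lambda>x. kernel_op (euler Q \<gamma> 0 (Gam \<gamma> n)) f x - kernel_op (P (Gam \<gamma> n)) f x)
          \<le> ennreal K * sup_norm f * ennreal (\<gamma> n powr (min (p * \<beta>) \<alpha> - \<epsilon>))" .
    qed
  next
    fix \<nu> \<nu>' assume "invariant_prob P \<nu>" "invariant_prob P \<nu>'"
    with rho(1) lip show "\<nu>' = \<nu>" by (rule invariant_prob_unique)
  next
    fix \<nu> and \<epsilon> :: real assume \<nu>: "invariant_prob P \<nu>" and "\<epsilon> > 0"
    from err[OF this(2)] obtain K where K: "0 \<le> K"
      "\<And>f S n x. 1 \<le> n \<Longrightarrow> f \<in> Mb \<Longrightarrow> sup_norm f = ennreal S \<Longrightarrow> 0 \<le> S \<Longrightarrow>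
      \<bar>kernel_op (euler Q \<gamma> 0 (Gam \<gamma> n)) f x - kernel_op (P (Gam \<gamma> n)) f x\<bar>
        \<le> K * S * \<gamma> n powr (min (p * \<beta>) \<alpha> - \<epsilon>)" by blast
    show "\<exists>C::real. \<forall>x. \<forall>n.
               3 \<le> Gam \<gamma> n \<and> Nidx \<gamma> (Gam \<gamma> n - 3) > n_star \<and> Nidx \<gamma> (Gam \<gamma> n - 2) > n_rho + 1 \<longrightarrow>
               tv_dist (euler Q \<gamma> 0 (Gam \<gamma> n) x) \<nu>
                 \<le> ennreal C * (ennreal (\<gamma> n powr (min (p * \<beta>) \<alpha> - \<epsilon>))
                     + (\<integral>\<^sup>+y. ennreal (dist x y) \<partial>\<nu>) * ennreal (exp (- \<rho> * Gam \<gamma> n)))"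
    \<comment> \<open>\<open>K\<close> pays for the passage from the scheme to the semigroup at the
      same time, \<open>D\<^sub>0\<close> for the passage from the semigroup to \<nu>; test
      functions are bounded by 1, so no norm of f remains.\<close>
    proof (intro exI[of _ "max K D\<^sub>0"] allI impI)
      fix x n
      assume n: "3 \<le> Gam \<gamma> n \<and> Nidx \<gamma> (Gam \<gamma> n - 3) > n_star \<and> Nidx \<gamma> (Gam \<gamma> n - 2) > n_rho + 1"
      let ?T = "Gam \<gamma> n" and ?\<theta> = "min (p * \<beta>) \<alpha> - \<epsilon>" and ?I = "\<integral>\<^sup>+y. ennreal (dist x y) \<partial>\<nu>"
      show "tv_dist (euler Q \<gamma> 0 ?T x) \<nu>
          \<le> ennreal (max K D\<^sub>0) * (ennreal (\<gamma> n powr ?\<theta>) + ?I * ennreal (exp (- \<rho> * ?T)))"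
        unfolding tv_dist_def
      proof (rule SUP_least)
        fix f :: "real ^ 'd \<Rightarrow> real" assume "f \<in> {f \<in> borel_measurable borel. sup_norm f \<le> 1}"
        then have fm: "f \<in> borel_measurable borel" and f1: "sup_norm f \<le> ennreal 1" by auto
        have f1': "\<bar>f y\<bar> \<le> 1" for y using f1 by (simp add: sup_norm_le_iff del: ennreal_1)
        have f: "f \<in> Mb" using fm f1' by (rule MbI)
        obtain S where S: "0 \<le> S" "sup_norm f = ennreal S" using f by (rule MbE)
        then have S1: "S \<le> 1" using f1 by simp
        have "\<bar>kernel_op (euler Q \<gamma> 0 ?T) f x - kernel_op (P ?T) f x\<bar> \<le> K * S * \<gamma> n powr ?\<theta>"
          using n n1 by (intro K(2) f S) auto
        also have "\<dots> \<le> max K D\<^sub>0 * 1 * \<gamma> n powr ?\<theta>"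
          using S S1 K(1) by (intro mult_right_mono mult_mono) auto
        finally have a: "ennreal \<bar>kernel_op (euler Q \<gamma> 0 ?T) f x - kernel_op (P ?T) f x\<bar>
            \<le> ennreal (max K D\<^sub>0) * ennreal (\<gamma> n powr ?\<theta>)"
          using K(1) by (simp add: ennreal_leI flip: ennreal_mult)
        have "ennreal \<bar>kernel_op (P ?T) f x - (\<integral>y. f y \<partial>\<nu>)\<bar> \<le> ennreal (D\<^sub>0 * 1 * exp (- \<rho> * ?T)) * ?I"
          using n D\<^sub>0(1) lip[OF _ f f1', of ?T x] by (intro invariant_prob_deviation[OF \<nu> _ f]) auto
        also have "\<dots> \<le> ennreal (max K D\<^sub>0 * exp (- \<rho> * ?T)) * ?I"
          by (intro mult_right_mono ennreal_leI) auto
        also have "\<dots> = ennreal (max K D\<^sub>0) * (?I * ennreal (exp (- \<rho> * ?T)))"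
          using K(1) by (simp add: ennreal_mult mult_ac)
        finally have b: "ennreal \<bar>kernel_op (P ?T) f x - (\<integral>y. f y \<partial>\<nu>)\<bar>
            \<le> ennreal (max K D\<^sub>0) * (?I * ennreal (exp (- \<rho> * ?T)))" .
        have "ennreal \<bar>(\<integral>y. f y \<partial>euler Q \<gamma> 0 ?T x) - (\<integral>y. f y \<partial>\<nu>)\<bar>
            \<le> ennreal (\<bar>kernel_op (euler Q \<gamma> 0 ?T) f x - kernel_op (P ?T) f x\<bar>
              + \<bar>kernel_op (P ?T) f x - (\<integral>y. f y \<partial>\<nu>)\<bar>)"
          by (intro ennreal_leI) (simp add: kernel_op_def)
        also have "\<dots> \<le> ennreal (max K D\<^sub>0) * (ennreal (\<gamma> n powr ?\<theta>) + ?I * ennreal (exp (- \<rho> * ?T)))"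
          using add_mono[OF a b] by (simp add: distrib_left)
        finally show "ennreal \<bar>(\<integral>y. f y \<partial>euler Q \<gamma> 0 ?T x) - (\<integral>y. f y \<partial>\<nu>)\<bar>
            \<le> ennreal (max K D\<^sub>0) * (ennreal (\<gamma> n powr ?\<theta>) + ?I * ennreal (exp (- \<rho> * ?T)))" .
      qed
    qed
  qed
qed

end
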